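(* Let $n\ge2$, $k\ge1$ and let $w$ be a unitary in $\mathcal F_n^k\cap\mathcal N_{\mathcal O_n}(\mathcal D_n)$. If the ring $A_w^D$ is nilpotent then $\lambda_w$ restricts to an automorphism of $\mathcal D_n$. More precisely, the following conditions are equivalent: (1) $\lambda_w$ restricts to an automorphism of the algebraic part $\bigcup_s\mathcal D_n^s$ of $\mathcal D_n$; (2) the ring $A_w^D$ is nilpotent; (3) $\Xi_w^D\subseteq B_w\cap\mathcal D_n^{k-1}$; (4) $\Xi_w^D=\mathbb C1$.
   Context: For $n\ge2$, $\mathcal O_n$ is the Cuntz algebra, generated by isometries $S_1,\dots,S_n$ with $\sum_i S_iS_i^*=1$. $W_n^k$ is the set of $k$-tuples from $\{1,\dots,n\}$ ($W_n^0$ contains only the empty word), and $S_\alpha=S_{\alpha_1}\cdots S_{\alpha_k}$ ($S_\emptyset=1$). $\mathcal F_n^k=\mathrm{span}\{S_\alpha S_\beta^*:\alpha,\beta\in W_n^k\}\cong M_{n^k}(\mathbb C)$, $\mathcal F_n^0=\mathbb C1$. $\mathcal D_n$ is the $C^*$-subalgebra generated by all projections $P_\alpha=S_\alpha S_\alpha^*$, and $\mathcal D_n^k=\mathcal D_n\cap\mathcal F_n^k=\mathrm{span}\{P_\alpha:\alpha\in W_n^k\}$. $\mathcal N_{\mathcal O_n}(\mathcal D_n)$ is the group of unitaries $w\in\mathcal O_n$ with $w\mathcal D_nw^*=\mathcal D_n$. $\varphi(a)=\sum_{i}S_iaS_i^*$. For a unitary $u\in\mathcal O_n$, $\lambda_u$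 is the unital endomorphism of $\mathcal O_n$ with $\lambda_u(S_i)=u^*S_i$. For $w$ as in the claim: - $B_w=\{w,\varphi(w),\dots,\varphi^{k-2}(w)\}'\cap\mathcal F_n^{k-1}$ if $k\ge2$ (prime denotes commutant), $B_w=\mathbb C1$ if $k=1$. - $a_{ij}^w(x)=S_i^*wxw^*S_j$ for $x\in\mathcal F_n^{k-1}$, $i,j\in\{1,\dots,n\}$. Both $\mathcal D_n^{k-1}$ and $B_w\cap\mathcal D_n^{k-1}$ are invariant under all $a_{ij}^w$; $b_{ij}^w$ denotes the restriction of $a_{ij}^w$ to $\mathcal D_n^{k-1}$, and $\tilde b_{ij}^w$ the induced linear map on $V_w^D=\mathcal D_n^{k-1}/(B_w\cap\mathcal D_n^{k-1})$. - $A_w^D$ is the (not necessarily unital) subring of the ring of linear maps $V_w^D\to V_w^D$ generated by all $\tilde b_{ij}^w$. Nilpotent means that some power of the ring is zero. - $\Xi_w^D=\bigcap_{r}(K^* )^r\mathcal D_n^{k-1}K^r$, where $K=\mathrm{span}\{w^*S_1,\dots,w^*S_n\}$ and $(K^* )^r\mathcal D_n^{k-1}K^r$ is the linear span of all products $y_r^*\cdots y_1^*\,x\,z_1\cdots z_r$ with $x\in\mathcal D_n^{k-1}$, $y_i,z_i\in K$. *)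

theory Defs
  imports Complex_Main "HOL-Library.Set_Algebras" "HOL-Library.FuncSet"
    "HOL-Algebra.Ring" "HOL-Algebra.Generated_Groups"
begin

section \<open>Unital C*-algebras\<close>

class cstar_algebra = real_normed_algebra_1 + banach +
  fixes scaleC :: "complex \<Rightarrow> 'a \<Rightarrow> 'a"  (infixr \<open>*\<^sub>C\<close> 75)
    and star :: "'a \<Rightarrow> 'a"
  assumes scaleC_add_right: "c *\<^sub>C (x + y) = c *\<^sub>C x + c *\<^sub>C y"
    and scaleC_add_left: "(c + d) *\<^sub>C x = c *\<^sub>C x + d *\<^sub>C x"
    and scaleC_scaleC: "c *\<^sub>C d *\<^sub>C x = (c * d) *\<^sub>C x"
    and scaleC_one: "1 *\<^sub>C x = x"
    and scaleR_scaleC: "r *\<^sub>R x = complex_of_real r *\<^sub>C x"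
    and mult_scaleC_left: "(c *\<^sub>C x) * y = c *\<^sub>C (x * y)"
    and mult_scaleC_right: "x * (c *\<^sub>C y) = c *\<^sub>C (x * y)"
    and norm_scaleC: "norm (c *\<^sub>C x) = cmod c * norm x"
    and star_star: "star (star x) = x"
    and star_add: "star (x + y) = star x + star y"
    and star_scaleC: "star (c *\<^sub>C x) = cnj c *\<^sub>C star x"
    and star_mult: "star (x * y) = star y * star x"
    and cstar_identity: "norm (star x * x) = (norm x)\<^sup>2"

global_interpretation cvec: vector_space "scaleC :: complex \<Rightarrow> 'a \<Rightarrow> 'a::cstar_algebra"
  by standard (simp_all add: scaleC_add_right scaleC_add_left scaleC_scaleC scaleC_one)

definition unitary :: "'a::cstar_algebra \<Rightarrow> bool" where
  "unitary u \<longleftrightarrow> star u * u = 1 \<and> u * star u = 1"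

definition cstar_subalgebra :: "'a::cstar_algebra set \<Rightarrow> bool" where
  "cstar_subalgebra B \<longleftrightarrow> cvec.subspace B \<and> closed B \<and>
     (\<forall>x\<in>B. \<forall>y\<in>B. x * y \<in> B) \<and> (\<forall>x\<in>B. star x \<in> B)"

definition cstar_generated :: "'a::cstar_algebra set \<Rightarrow> 'a set" where
  "cstar_generated X = \<Inter>{B. X \<subseteq> B \<and> cstar_subalgebra B}"

definition commutant :: "'a::cstar_algebra set \<Rightarrow> 'a set" where
  "commutant X = {x. \<forall>y\<in>X. x * y = y * x}"

definition unital_star_endomorphism :: "('a::cstar_algebra \<Rightarrow> 'a) \<Rightarrow> bool" where
  "unital_star_endomorphism f \<longleftrightarrow>
     (\<forall>x y. f (x + y) = f x + f y) \<and> (\<forall>c x. f (c *\<^sub>C x) = c *\<^sub>C f x) \<and>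
     (\<forall>x y. f (x * y) = f x * f y) \<and> (\<forall>x. f (star x) = star (f x)) \<and> f 1 = 1"

text \<open>For a *-endomorphism \<open>f\<close> and a *-subalgebra \<open>B\<close>, the restriction of \<open>f\<close> to \<open>B\<close> preserves
  the operations automatically, so only bijectivity of \<open>B \<rightarrow> B\<close> has to be required.\<close>

definition restricts_to_automorphism :: "('a::cstar_algebra \<Rightarrow> 'a) \<Rightarrow> 'a set \<Rightarrow> bool" where
  "restricts_to_automorphism f B \<longleftrightarrow> bij_betw f B B"


section \<open>The Cuntz algebra\<close>

text \<open>The type \<open>'a\<close> plays the role of the Cuntz algebra with canonical generators
  \<open>S 1, \<dots>, S n\<close>. By Cuntz's uniqueness theorem, for \<open>n \<ge> 2\<close> these conditions determine \<open>('a, S)\<close>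
  up to isomorphism.\<close>

definition cuntz_generators :: "nat \<Rightarrow> (nat \<Rightarrow> 'a::cstar_algebra) \<Rightarrow> bool" where
  "cuntz_generators n S \<longleftrightarrow>
     (\<forall>i\<in>{1..n}. star (S i) * S i = 1) \<and> (\<Sum>i=1..n. S i * star (S i)) = 1 \<and>
     cstar_generated (S ` {1..n}) = UNIV"

text \<open>\<open>f\<close> is the endomorphism \<open>\<lambda>\<^sub>u\<close>; since \<open>S 1, \<dots>, S n\<close> generate, there is at most one such \<open>f\<close>.\<close>

definition is_cuntz_endomorphism ::
    "nat \<Rightarrow> (nat \<Rightarrow> 'a::cstar_algebra) \<Rightarrow> 'a \<Rightarrow> ('a \<Rightarrow> 'a) \<Rightarrow> bool" where
  "is_cuntz_endomorphism n S u f \<longleftrightarrow>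
     unital_star_endomorphism f \<and> (\<forall>i\<in>{1..n}. f (S i) = star u * S i)"

definition words :: "nat \<Rightarrow> nat \<Rightarrow> nat list set" where
  "words n k = {\<alpha>. set \<alpha> \<subseteq> {1..n} \<and> length \<alpha> = k}"

definition S_word :: "(nat \<Rightarrow> 'a::cstar_algebra) \<Rightarrow> nat list \<Rightarrow> 'a" where
  "S_word S \<alpha> = prod_list (map S \<alpha>)"

definition F_alg :: "nat \<Rightarrow> (nat \<Rightarrow> 'a::cstar_algebra) \<Rightarrow> nat \<Rightarrow> 'a set" where
  "F_alg n S k = cvec.span {S_word S \<alpha> * star (S_word S \<beta>) | \<alpha> \<beta>. \<alpha> \<in> words n k \<and> \<beta> \<in> words n k}"

definition P_word :: "(nat \<Rightarrow> 'a::cstar_algebra) \<Rightarrow> nat list \<Rightarrow> 'a" where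
  "P_word S \<alpha> = S_word S \<alpha> * star (S_word S \<alpha>)"

definition diagonal :: "nat \<Rightarrow> (nat \<Rightarrow> 'a::cstar_algebra) \<Rightarrow> 'a set" where
  "diagonal n S = cstar_generated (\<Union>k. P_word S ` words n k)"

definition D_alg :: "nat \<Rightarrow> (nat \<Rightarrow> 'a::cstar_algebra) \<Rightarrow> nat \<Rightarrow> 'a set" where
  "D_alg n S k = diagonal n S \<inter> F_alg n S k"

definition diag_normalizer :: "nat \<Rightarrow> (nat \<Rightarrow> 'a::cstar_algebra) \<Rightarrow> 'a set" where
  "diag_normalizer n S =
     {w. unitary w \<and> (\<lambda>d. w * d * star w) ` diagonal n S = diagonal n S}"

definition shift :: "nat \<Rightarrow> (nat \<Rightarrow> 'a::cstar_algebra) \<Rightarrow> 'a \<Rightarrow> 'a" where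
  "shift n S a = (\<Sum>i=1..n. S i * a * star (S i))"

definition B_alg :: "nat \<Rightarrow> (nat \<Rightarrow> 'a::cstar_algebra) \<Rightarrow> nat \<Rightarrow> 'a \<Rightarrow> 'a set" where
  "B_alg n S k w =
     (if k \<ge> 2 then commutant {(shift n S ^^ m) w | m. m \<le> k - 2} \<inter> F_alg n S (k - 1)
      else cvec.span {1})"

definition a_map :: "(nat \<Rightarrow> 'a::cstar_algebra) \<Rightarrow> 'a \<Rightarrow> nat \<Rightarrow> nat \<Rightarrow> 'a \<Rightarrow> 'a" where
  "a_map S w i j x = star (S i) * w * x * star w * S j"


section \<open>Linear maps on a quotient space\<close>

text \<open>The quotient of \<open>V\<close> by a subspace \<open>U\<close> consists of the cosets \<open>x +o U\<close>; their sum is the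
  elementwise sum of sets. In the scalar multiple, \<open>U\<close> is added so that \<open>c = 0\<close> yields the
  coset \<open>U\<close> rather than \<open>{0}\<close>.\<close>

definition quot_space :: "'a::cstar_algebra set \<Rightarrow> 'a set \<Rightarrow> 'a set set" where
  "quot_space V U = (\<lambda>x. x +o U) ` V"

definition quot_scale :: "'a::cstar_algebra set \<Rightarrow> complex \<Rightarrow> 'a set \<Rightarrow> 'a set" where
  "quot_scale U c X = (\<lambda>x. c *\<^sub>C x) ` X + U"

definition quot_End :: "'a::cstar_algebra set \<Rightarrow> 'a set \<Rightarrow> ('a set \<Rightarrow> 'a set) ring" where
  "quot_End V U =
     \<lparr>carrier = {f \<in> quot_space V U \<rightarrow>\<^sub>E quot_space V U.
         (\<forall>X\<in>quot_space V U. \<forall>Y\<in>quot_space V U. f (X + Y) = f X + f Y) \<and>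
         (\<forall>c. \<forall>X\<in>quot_space V U. f (quot_scale U c X) = quot_scale U c (f X))},
      mult = compose (quot_space V U),
      one = (\<lambda>X\<in>quot_space V U. X),
      zero = (\<lambda>X\<in>quot_space V U. U),
      add = (\<lambda>f g. \<lambda>X\<in>quot_space V U. f X + g X)\<rparr>"

text \<open>The map induced by \<open>f\<close>, sending \<open>x +o U\<close> to \<open>f x +o U\<close>; meaningful if \<open>f\<close> leaves \<open>V\<close> and
  \<open>U\<close> invariant.\<close>

definition quot_map ::
    "'a::cstar_algebra set \<Rightarrow> 'a set \<Rightarrow> ('a \<Rightarrow> 'a) \<Rightarrow> 'a set \<Rightarrow> 'a set" where
  "quot_map V U f = (\<lambda>X\<in>quot_space V U. the_elem ((\<lambda>x. f x +o U) ` X))"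


section \<open>Nilpotent non-unital subrings\<close>

text \<open>Unlike \<open>generate_ring\<close> from HOL-Algebra, this does not adjoin \<open>\<one>\<close>.\<close>

inductive_set generate_rng :: "('a, 'b) ring_scheme \<Rightarrow> 'a set \<Rightarrow> 'a set"
  for R and H where
    zero: "\<zero>\<^bsub>R\<^esub> \<in> generate_rng R H"
  | incl: "h \<in> H \<Longrightarrow> h \<in> generate_rng R H"
  | a_inv: "h \<in> generate_rng R H \<Longrightarrow> \<ominus>\<^bsub>R\<^esub> h \<in> generate_rng R H"
  | add: "\<lbrakk>h1 \<in> generate_rng R H; h2 \<in> generate_rng R H\<rbrakk> \<Longrightarrow> h1 \<oplus>\<^bsub>R\<^esub> h2 \<in> generate_rng R H"
  | mult: "\<lbrakk>h1 \<in> generate_rng R H; h2 \<in> generate_rng R H\<rbrakk> \<Longrightarrow> h1 \<otimes>\<^bsub>R\<^esub> h2 \<in> generate_rng R H"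

text \<open>For \<open>m \<ge> 1\<close>, the power \<open>A\<^sup>m\<close>: the additive group generated by all \<open>m\<close>-fold products
  of elements of \<open>A\<close>.\<close>

definition rng_power :: "('a, 'b) ring_scheme \<Rightarrow> 'a set \<Rightarrow> nat \<Rightarrow> 'a set" where
  "rng_power R A m =
     generate (add_monoid R) {foldr (mult R) xs \<one>\<^bsub>R\<^esub> | xs. set xs \<subseteq> A \<and> length xs = m}"

definition nilpotent_rng :: "('a, 'b) ring_scheme \<Rightarrow> 'a set \<Rightarrow> bool" where
  "nilpotent_rng R A \<longleftrightarrow> (\<exists>m\<ge>1. rng_power R A m = {\<zero>\<^bsub>R\<^esub>})"


section \<open>The ring and the subspace attached to a unitary\<close>

definition VD_End ::
    "nat \<Rightarrow> (nat \<Rightarrow> 'a::cstar_algebra) \<Rightarrow> nat \<Rightarrow> 'a \<Rightarrow> ('a set \<Rightarrow> 'a set) ring" where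
  "VD_End n S k w = quot_End (D_alg n S (k - 1)) (B_alg n S k w \<inter> D_alg n S (k - 1))"

definition b_tilde ::
    "nat \<Rightarrow> (nat \<Rightarrow> 'a::cstar_algebra) \<Rightarrow> nat \<Rightarrow> 'a \<Rightarrow> nat \<Rightarrow> nat \<Rightarrow> 'a set \<Rightarrow> 'a set" where
  "b_tilde n S k w i j =
     quot_map (D_alg n S (k - 1)) (B_alg n S k w \<inter> D_alg n S (k - 1)) (a_map S w i j)"

definition A_ring ::
    "nat \<Rightarrow> (nat \<Rightarrow> 'a::cstar_algebra) \<Rightarrow> nat \<Rightarrow> 'a \<Rightarrow> ('a set \<Rightarrow> 'a set) set" where
  "A_ring n S k w =
     generate_rng (VD_End n S k w) {b_tilde n S k w i j | i j. i \<in> {1..n} \<and> j \<in> {1..n}}"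

definition K_space :: "nat \<Rightarrow> (nat \<Rightarrow> 'a::cstar_algebra) \<Rightarrow> 'a \<Rightarrow> 'a set" where
  "K_space n S w = cvec.span ((\<lambda>i. star w * S i) ` {1..n})"

definition sandwich :: "'a::cstar_algebra set \<Rightarrow> 'a set \<Rightarrow> nat \<Rightarrow> 'a set" where
  "sandwich K D r =
     cvec.span {prod_list (map star (rev ys)) * x * prod_list zs | ys x zs.
       x \<in> D \<and> set ys \<subseteq> K \<and> set zs \<subseteq> K \<and> length ys = r \<and> length zs = r}"

definition Xi_space :: "nat \<Rightarrow> (nat \<Rightarrow> 'a::cstar_algebra) \<Rightarrow> nat \<Rightarrow> 'a \<Rightarrow> 'a set" where
  "Xi_space n S k w = (\<Inter>r. sandwich (K_space n S w) (D_alg n S (k - 1)) r)"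

end

theory Submission
  imports Defs "HOL-Analysis.Elementary_Normed_Spaces"
begin

text \<open>Write \<open>V = D (k - 1)\<close> and \<open>K\<close> for the span of the isometries \<open>w\<^sup>* S i = \<lambda> (S i)\<close>.
Everything is decided by the decreasing chain of subspaces \<open>X r = (K\<^sup>*)\<^sup>r V K\<^sup>r\<close>, whose
intersection is \<open>\<Xi>\<close>. Multiplying by \<open>K\<^sup>*\<close> on the left and by \<open>K\<close> on the right amounts to
applying the maps \<open>a i j\<close>, so \<open>X r\<close> is the span of all \<open>r\<close>-fold composites of the \<open>a i j\<close>
applied to \<open>V\<close>. Each \<open>X r\<close> contains \<open>1\<close>, and since \<open>V\<close> has finite dimension the chain
is eventually constant, so \<open>\<Xi> = X r\<close> for large \<open>r\<close>.

Nilpotency of the ring says that for some \<open>m\<close> all \<open>m\<close>-fold composites of the \<open>a i j\<close> map \<open>V\<close>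
into \<open>B \<inter> V\<close>, i.e. \<open>X m \<subseteq> B \<inter> V\<close> (\<open>nilpotent_generate_rng_iff\<close>); as the chain stabilizes,
this means \<open>\<Xi> \<subseteq> B \<inter> V\<close>. On \<open>B\<close> the conjugation by \<open>w\<close> disappears from \<open>a i j\<close>, which becomes
\<open>x \<mapsto> S i\<^sup>* x S j\<close> and lowers the level in the chain \<open>F (k - 1) \<supseteq> \<dots> \<supseteq> F 0 = \<complex>1\<close> by one. Hence
\<open>X m \<subseteq> B\<close> forces \<open>X (m + k - 1) = \<complex>1\<close>, and \<open>\<Xi> \<subseteq> B\<close> is the same as \<open>\<Xi> = \<complex>1\<close>.

For the endomorphism, the elements of \<open>X r\<close> are combinations of compressions
\<open>\<lambda>(S \<alpha>)\<^sup>* x \<lambda>(S \<beta>)\<close> with \<open>x \<in> V\<close> and \<open>\<alpha>\<close>, \<open>\<beta>\<close> of length \<open>r\<close>. A compression of an element of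
\<open>D (k - 1 + l)\<close> by words of length \<open>l\<close> lies in \<open>V\<close>. So if \<open>X m = \<complex>1\<close>, then the compressions of
any \<open>x\<close> in the algebraic part by sufficiently long words are scalars \<open>c \<alpha>\<close> for \<open>\<alpha> = \<beta>\<close>, and
\<open>x\<close> equals \<open>\<Sum>\<alpha>. \<lambda>(P \<alpha>) x \<lambda>(P \<alpha>) = \<lambda>(\<Sum>\<alpha>. c \<alpha> P \<alpha>)\<close>, so \<open>\<lambda>\<close> maps onto the
algebraic part of the diagonal (\<open>D_subset_lam_image\<close>). Conversely, if \<open>V \<subseteq> \<lambda>(D m)\<close> then all
compressions by words of length \<open>m\<close> are images of scalars (\<open>X_scalars_if_lam_image_D\<close>).
Finally \<open>\<lambda>\<close> is isometric on each \<open>D s\<close>, hence on the closure of their union, which is the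
whole diagonal; so bijectivity on the algebraic part passes to the diagonal.

Two analytic facts about abstract C*-algebras are needed underneath: the ranges of the isometries
\<open>S i\<close> are orthogonal, which has to be derived from the sum of the range projections being \<open>1\<close>,
and *-endomorphisms are contractive. Both rest on the square root of \<open>1 - x\<close> for small
selfadjoint \<open>x\<close> and on \<open>\<parallel>x\<parallel>\<^sup>2 \<le> \<parallel>x\<^sup>2 + y\<^sup>2\<parallel>\<close> for commuting selfadjoint \<open>x\<close>, \<open>y\<close>; no spectral
theory is used.\<close>

section \<open>Norm estimates in C*-algebras\<close>

lemma star_0 [simp]: "star (0 :: 'a::cstar_algebra) = 0"
  by (metis add_cancel_right_right star_add)

lemma star_minus [simp]: "star (- x :: 'a::cstar_algebra) = - star x"
  by (metis add.right_inverse add_eq_0_iff star_0 star_add)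

lemma star_diff: "star (x - y :: 'a::cstar_algebra) = star x - star y"
  by (metis diff_conv_add_uminus star_add star_minus)

lemma star_1 [simp]: "star (1 :: 'a::cstar_algebra) = 1"
  by (metis mult.right_neutral mult_1 star_mult star_star)

lemma star_sum: "star (\<Sum>i\<in>I. f i :: 'a::cstar_algebra) = (\<Sum>i\<in>I. star (f i))"
  by (induction I rule: infinite_finite_induct) (auto simp: star_add)

lemma star_scaleR [simp]: "star (r *\<^sub>R x :: 'a::cstar_algebra) = r *\<^sub>R star x"
  by (simp add: scaleR_scaleC star_scaleC)

lemma norm_star [simp]: "norm (star x :: 'a::cstar_algebra) = norm x"
proof -
  have le: "norm y \<le> norm (star y)" for y :: 'a
  proof (cases "y = 0")
    case False
    have "norm y * norm y \<le> norm (star y) * norm y"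
      by (metis cstar_identity norm_mult_ineq power2_eq_square)
    then show ?thesis using False by simp
  qed simp
  show ?thesis using le[of x] le[of "star x"] by (simp add: star_star)
qed

lemma norm_square_selfadjoint:
  fixes x :: "'a::cstar_algebra"
  assumes "star x = x"
  shows "norm (x * x) = (norm x)\<^sup>2"
  using cstar_identity[of x] assms by simp

lemma continuous_on_star: "continuous_on A (star :: 'a::cstar_algebra \<Rightarrow> 'a)"
proof -
  have "dist (star x) (star y) = dist x y" for x y :: 'a
    by (simp add: dist_norm flip: star_diff)
  then show ?thesis by (auto simp: continuous_on_iff)
qed

lemma tendsto_star:
  fixes f :: "'b \<Rightarrow> 'a::cstar_algebra"
  assumes "(f \<longlongrightarrow> l) F"
  shows "((\<lambda>x. star (f x)) \<longlongrightarrow> star l) F"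
  using assms continuous_on_star[of UNIV] continuous_on_tendsto_compose by fastforce

lemma continuous_on_scaleC: "continuous_on A ((*\<^sub>C) c :: 'a::cstar_algebra \<Rightarrow> 'a)"
proof -
  have "bounded_linear ((*\<^sub>C) c :: 'a \<Rightarrow> 'a)"
    by (rule bounded_linear_intro[where K = "cmod c"])
       (simp_all add: scaleC_add_right scaleR_scaleC scaleC_scaleC norm_scaleC mult.commute)
  then show ?thesis by (rule linear_continuous_on)
qed

text \<open>The root is \<open>1 - y\<close> for a fixed point \<open>y\<close> of \<open>y \<mapsto> (x + y\<^sup>2) / 2\<close>. On the ball whose radius \<open>\<rho>\<close>
solves \<open>\<parallel>x\<parallel> + \<rho>\<^sup>2 = 2 \<rho>\<close> this map is a contraction with constant \<open>\<rho> < 1\<close>. It also preserves the closed set of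
selfadjoint elements that commute with everything commuting with \<open>x\<close>, so the fixed point
inherits these properties.\<close>

lemma selfadjoint_sqrt:
  fixes x :: "'a::cstar_algebra"
  assumes sa: "star x = x" and x: "norm x < 1"
  obtains y where "star y = y" "y * y = 1 - x" "\<And>z. z * x = x * z \<Longrightarrow> z * y = y * z"
proof -
  define \<rho> where "\<rho> = 1 - sqrt (1 - norm x)"
  define f where "f y = (1 / 2) *\<^sub>R (x + y * y)" for y :: 'a
  define Z where "Z = {z. z * x = x * z}"
  define C where "C = {y. norm y \<le> \<rho> \<and> star y = y \<and> (\<forall>z\<in>Z. z * y = y * z)}"
  have \<rho>: "0 \<le> \<rho>" "\<rho> < 1" "norm x + \<rho> * \<rho> = 2 * \<rho>"
    using x by (auto simp: \<rho>_def algebra_simps)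
  have "closed (cball (0::'a) \<rho> \<inter> {y. star y = y} \<inter> (\<Inter>z\<in>Z. {y. z * y = y * z}))"
    by (intro closed_Int closed_cball closed_INT ballI closed_Collect_eq
        continuous_on_star continuous_intros)
  also have "cball (0::'a) \<rho> \<inter> {y. star y = y} \<inter> (\<Inter>z\<in>Z. {y. z * y = y * z}) = C"
    unfolding C_def by auto
  finally have "complete C" by (simp add: complete_eq_closed)
  have maps: "f ` C \<subseteq> C"
  proof clarify
    fix y assume "y \<in> C"
    then have y: "norm y \<le> \<rho>" "star y = y" "\<And>z. z \<in> Z \<Longrightarrow> z * y = y * z"
      by (simp_all add: C_def)
    have "norm (f y) \<le> (1 / 2) * (norm x + norm y * norm y)"
      unfolding f_def using norm_triangle_ineq[of x "y * y"] norm_mult_ineq[of y y] by simp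
    also have "\<dots> \<le> (1 / 2) * (norm x + \<rho> * \<rho>)"
      using y(1) \<rho> by (intro mult_left_mono add_left_mono mult_mono) auto
    finally have "norm (f y) \<le> \<rho>" using \<rho> by simp
    moreover have "z * f y = f y * z" if "z \<in> Z" for z
    proof -
      have "z * (y * y) = (y * y) * z" using y(3)[OF that] by (metis mult.assoc)
      moreover have "z * x = x * z" using that by (simp add: Z_def)
      ultimately show ?thesis by (simp add: f_def distrib_left distrib_right)
    qed
    moreover have "star (f y) = f y" using y(2) sa by (simp add: f_def star_add star_mult)
    ultimately show "f y \<in> C" by (simp add: C_def)
  qed
  have lip: "dist (f y) (f z) \<le> \<rho> * dist y z" if "y \<in> C" "z \<in> C" for y z
  proof -
    have yz: "norm y \<le> \<rho>" "norm z \<le> \<rho>" using that by (simp_all add: C_def)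
    have "f y - f z = (1 / 2) *\<^sub>R (y * (y - z) + (y - z) * z)"
      by (simp add: f_def algebra_simps)
    then have "norm (f y - f z) \<le> (1 / 2) * (norm y * norm (y - z) + norm (y - z) * norm z)"
      using norm_triangle_ineq[of "y * (y - z)" "(y - z) * z"] norm_mult_ineq[of y "y - z"]
        norm_mult_ineq[of "y - z" z] by simp
    also have "\<dots> \<le> (1 / 2) * (\<rho> * norm (y - z) + norm (y - z) * \<rho>)"
      using yz by (intro mult_left_mono add_mono mult_mono) (auto simp: \<rho>)
    finally show ?thesis by (simp add: dist_norm)
  qed
  have "C \<noteq> {}" using \<rho> by (auto simp: C_def intro!: exI[of _ 0])
  with \<open>complete C\<close> have "\<exists>!y\<in>C. f y = y"
    using \<rho>(1,2) maps lip by (rule Banach_fix)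
  then obtain y where y: "y \<in> C" "f y = y" by blast
  have "2 *\<^sub>R f y = x + y * y" by (simp add: f_def)
  then have sq: "(1 - y) * (1 - y) = 1 - x"
    unfolding y(2) by (simp add: algebra_simps scaleR_2)
  show thesis
  proof (rule that[of "1 - y"])
    show "star (1 - y) = 1 - y" using y(1) by (simp add: C_def star_diff)
    show "(1 - y) * (1 - y) = 1 - x" by (rule sq)
    show "z * (1 - y) = (1 - y) * z" if "z * x = x * z" for z
    proof -
      have "z \<in> Z" using that by (simp add: Z_def)
      then show ?thesis using y(1) by (simp add: C_def right_diff_distrib left_diff_distrib)
    qed
  qed
qed

text \<open>For \<open>z = x + \<i> y\<close> the right-hand side is \<open>\<parallel>z\<^sup>* z\<parallel> = \<parallel>z\<parallel>\<^sup>2\<close>, and \<open>x\<close> is the real part of \<open>z\<close>.\<close>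

lemma norm_le_norm_sum_squares:
  fixes x y :: "'a::cstar_algebra"
  assumes "star x = x" "star y = y" "x * y = y * x"
  shows "(norm x)\<^sup>2 \<le> norm (x * x + y * y)"
proof -
  define z where "z = x + \<i> *\<^sub>C y"
  have sz: "star z = x - \<i> *\<^sub>C y"
    by (simp add: z_def star_add star_scaleC assms)
  have "star z * z = x * x + y * y"
    unfolding sz unfolding z_def
    by (simp add: algebra_simps mult_scaleC_left mult_scaleC_right scaleC_scaleC assms)
  then have "norm (x * x + y * y) = (norm z)\<^sup>2" by (metis cstar_identity)
  moreover have "norm x \<le> norm z"
  proof -
    have "2 *\<^sub>R x = z + star z" unfolding sz by (simp add: z_def scaleR_2)
    then have "2 * norm x \<le> norm z + norm (star z)"
      by (metis norm_scaleR norm_triangle_ineq abs_numeral)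
    then show ?thesis by simp
  qed
  ultimately show ?thesis by (simp add: power_mono)
qed

text \<open>This replaces the spectral argument that \<open>1 + c\<^sup>2\<close> has norm \<open>1 + \<parallel>c\<parallel>\<^sup>2\<close>. Squaring gives
\<open>(1 + c\<^sup>2)\<^sup>2 = 1 + d\<^sup>2\<close> with \<open>d\<^sup>2 = 2 c\<^sup>2 + c\<^sup>4\<close>, a square because \<open>1 + c\<^sup>2 / 2\<close> has a root. Thus
\<open>d\<close> satisfies the same hypothesis and \<open>\<parallel>d\<parallel>\<^sup>2 \<ge> 2 \<parallel>c\<parallel>\<^sup>2\<close>. Starting from \<open>\<parallel>c\<parallel>\<^sup>2 \<le> 1\<close> for
all such \<open>c\<close>, the bound improves by a factor of two indefinitely.\<close>

lemma selfadjoint_eq_0_if_norm_1_plus_square_le_1: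
  fixes c :: "'a::cstar_algebra"
  assumes "star c = c" "norm (1 + c * c) \<le> 1"
  shows "c = 0"
proof -
  have bound: "(norm c)\<^sup>2 \<le> (1 / 2) ^ m" if "star c = c" "norm (1 + c * c) \<le> 1" for m and c :: 'a
    using that
  proof (induction m arbitrary: c)
    case 0
    then show ?case using norm_le_norm_sum_squares[of c 1] by (simp add: add.commute)
  next
    case (Suc m)
    have c1: "(norm c)\<^sup>2 \<le> 1"
      using Suc.prems norm_le_norm_sum_squares[of c 1] by (simp add: add.commute)
    define x where "x = - ((1 / 2) *\<^sub>R (c * c))"
    have "star x = x" using Suc.prems by (simp add: x_def star_mult)
    moreover have "norm x < 1" using c1 Suc.prems by (simp add: x_def norm_square_selfadjoint)
    ultimately obtain y where y: "star y = y" "y * y = 1 - x" "\<And>z. z * x = x * z \<Longrightarrow> z * y = y * z"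
      by (metis selfadjoint_sqrt)
    have cy: "c * y = y * c" by (intro y) (simp add: x_def mult.assoc)
    \<comment> \<open>With this choice \<open>d * d = 2 *\<^sub>R (c * c) * (1 + (1 / 2) *\<^sub>R (c * c))\<close>.\<close>
    define d where "d = sqrt 2 *\<^sub>R (c * y)"
    have dsa: "star d = d" by (simp add: d_def star_mult Suc.prems y(1) cy)
    have "d * d = 2 *\<^sub>R ((c * c) * (y * y))"
      by (simp add: d_def) (metis cy mult.assoc)
    also have "\<dots> = 2 *\<^sub>R (c * c) + (c * c) * (c * c)"
      by (simp add: y(2) x_def algebra_simps)
    finally have dd: "d * d = 2 *\<^sub>R (c * c) + (c * c) * (c * c)" .
    have "1 + d * d = (1 + c * c) * (1 + c * c)" by (simp add: dd algebra_simps scaleR_2)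
    then have "norm (1 + d * d) \<le> 1"
      using Suc.prems(2) norm_mult_ineq[of "1 + c * c" "1 + c * c"] mult_le_one[of "norm (1 + c * c)" "norm (1 + c * c)"]
      by simp
    then have "(norm d)\<^sup>2 \<le> (1 / 2) ^ m" using Suc.IH dsa by blast
    moreover have "2 * (norm c)\<^sup>2 \<le> (norm d)\<^sup>2"
    proof -
      have "(norm (sqrt 2 *\<^sub>R c))\<^sup>2 \<le> norm ((sqrt 2 *\<^sub>R c) * (sqrt 2 *\<^sub>R c) + (c * c) * (c * c))"
        by (rule norm_le_norm_sum_squares) (simp_all add: Suc.prems star_mult mult.assoc)
      also have "\<dots> = norm (d * d)" by (simp add: dd)
      finally show ?thesis using norm_square_selfadjoint[OF dsa] by (simp add: power_mult_distrib)
    qed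
    ultimately show ?case by simp
  qed
  have "(\<lambda>m. (1 / 2 :: real) ^ m) \<longlonglongrightarrow> 0" by (simp add: LIMSEQ_realpow_zero)
  then have "(norm c)\<^sup>2 \<le> 0"
    by (rule LIMSEQ_le_const) (use bound assms in blast)
  then show ?thesis by simp
qed

text \<open>The mean of \<open>(1 + a)\<^sup>2\<close> and \<open>(1 - a)\<^sup>2\<close> is \<open>1 + a\<^sup>2\<close>, so the previous lemma applies.\<close>

lemma selfadjoint_eq_0_if_norm_1_plus_minus_le_1:
  fixes a :: "'a::cstar_algebra"
  assumes "star a = a" "norm (1 + a) \<le> 1" "norm (1 - a) \<le> 1"
  shows "a = 0"
proof -
  have "2 *\<^sub>R (1 + a * a) = (1 + a) * (1 + a) + (1 - a) * (1 - a)"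
    by (simp add: algebra_simps scaleR_2)
  then have "2 * norm (1 + a * a) \<le> norm ((1 + a) * (1 + a)) + norm ((1 - a) * (1 - a))"
    by (metis norm_scaleR norm_triangle_ineq abs_numeral)
  also have "\<dots> \<le> 1 + 1"
    by (intro add_mono order.trans[OF norm_mult_ineq] mult_le_one assms norm_ge_zero)
  finally show ?thesis
    using assms(1) by (intro selfadjoint_eq_0_if_norm_1_plus_square_le_1) simp_all
qed

lemma norm_selfadjoint_power_power_2:
  fixes h :: "'a::cstar_algebra"
  assumes "star h = h"
  shows "norm (h ^ (2 ^ m)) = norm h ^ (2 ^ m)"
proof (induction m)
  case (Suc m)
  have "star (h ^ j) = h ^ j" for j
    by (induction j) (simp_all add: star_mult assms power_commutes)
  then show ?case
    using norm_square_selfadjoint[of "h ^ (2 ^ m)"] Suc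
    by (simp add: power_even_eq flip: power2_eq_square power_mult)
qed simp

definition projection :: "'a::cstar_algebra \<Rightarrow> bool" where
  "projection p \<longleftrightarrow> star p = p \<and> p * p = p"

lemma norm_projection_le_1: "projection p \<Longrightarrow> norm p \<le> 1"
  using norm_square_selfadjoint[of p]
  by (cases "norm p = 0") (auto simp: projection_def power2_eq_square)

lemma projection_complement: "projection p \<Longrightarrow> projection (1 - p)"
  by (simp add: projection_def star_diff algebra_simps)

text \<open>This expresses \<open>0 \<le> p q p \<le> 1\<close> by norms. The element \<open>1 - p q p = (1 - p) + p (1 - q) p\<close> is a sum
of two contractions with product zero, so its powers have norm at most \<open>2\<close>; as it is selfadjoint,
its norm cannot exceed \<open>1\<close>.\<close>

lemma norm_1_minus_compression_le_1:
  fixes p q :: "'a::cstar_algebra"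
  assumes "projection p" "projection q"
  shows "norm (1 - p * q * p) \<le> 1"
proof -
  define d where "d = 1 - p"
  define e where "e = p * (1 - q) * p"
  have p: "star p = p" "p * p = p" and q: "star q = q"
    using assms by (auto simp: projection_def)
  have de: "d * e = 0" "e * d = 0" "d * d = d"
    using p by (simp_all add: d_def e_def algebra_simps) (simp_all flip: mult.assoc)
  have sum: "1 - p * q * p = d + e" using p by (simp add: d_def e_def algebra_simps)
  have sa: "star (d + e) = d + e"
    by (simp add: d_def e_def star_diff star_mult star_add p q mult.assoc)
  have e1: "norm e \<le> 1"
    unfolding e_def
    by (intro order.trans[OF norm_mult_ineq] mult_le_one norm_projection_le_1 projection_complement assms norm_ge_zero)
  have d1: "norm d \<le> 1"
    unfolding d_def by (intro norm_projection_le_1 projection_complement assms)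
  have pow: "(d + e) ^ Suc m = d + e ^ Suc m" for m
  proof (induction m)
    case (Suc m)
    have "(d + e) ^ Suc (Suc m) = (d + e) * (d + e ^ Suc m)" using Suc by (metis power_Suc)
    also have "\<dots> = d + e ^ Suc (Suc m)"
      using de by (simp add: distrib_left distrib_right flip: mult.assoc)
    finally show ?case .
  qed simp
  have "norm (d + e) ^ (2 ^ m) \<le> 2" for m
  proof -
    have "norm (d + e) ^ (2 ^ m) = norm ((d + e) ^ (2 ^ m))"
      using norm_selfadjoint_power_power_2[OF sa] by simp
    also have "\<dots> = norm (d + e ^ (2 ^ m))"
      using pow[of "2 ^ m - 1"] by simp
    also have "\<dots> \<le> 1 + 1"
      using d1 norm_power_ineq[of e "2 ^ m"] power_le_one[OF _ e1, of "2 ^ m"]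
      by (intro order.trans[OF norm_triangle_ineq] add_mono) auto
    finally show ?thesis by simp
  qed
  note bound = this
  have "norm (d + e) \<le> 1"
  proof (rule ccontr)
    assume "\<not> norm (d + e) \<le> 1"
    then have gt: "1 < norm (d + e)" by simp
    then obtain m where "2 < norm (d + e) ^ m" using real_arch_pow by blast
    also have "norm (d + e) ^ m \<le> norm (d + e) ^ (2 ^ m)"
      using gt by (intro power_increasing) (auto simp: less_imp_le)
    also have "\<dots> \<le> 2" by (rule bound)
    finally show False by simp
  qed
  then show ?thesis by (simp add: sum)
qed

text \<open>Compressing the relation \<open>\<Sum>l. p l = 1\<close> by \<open>p j\<close> shows that the elements \<open>a l = p j p l p j\<close>, \<open>l \<noteq> j\<close>,
add up to \<open>0\<close>. Each of them is positive in the sense that \<open>\<parallel>1 - a l\<parallel> \<le> 1\<close>, and \<open>- a i\<close>, being the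
sum of the others, is positive in the same sense up to a scalar. Hence \<open>a i = (p i p j)\<^sup>* (p i p j)\<close>
vanishes.\<close>

lemma projections_with_sum_1_orthogonal:
  fixes p :: "'b \<Rightarrow> 'a::cstar_algebra"
  assumes "finite I" "\<And>i. i \<in> I \<Longrightarrow> projection (p i)" "(\<Sum>i\<in>I. p i) = 1"
    and "i \<in> I" "j \<in> I" "i \<noteq> j"
  shows "p i * p j = 0"
proof -
  define J where "J = I - {j}"
  define a where "a l = p j * p l * p j" for l
  have pj: "star (p j) = p j" "p j * p j = p j" and pi: "star (p i) = p i" "p i * p i = p i"
    using assms by (auto simp: projection_def)
  have fin: "finite J" "i \<in> J" using assms by (auto simp: J_def)
  have "p j = p j * (\<Sum>l\<in>I. p l) * p j" using assms pj by simp
  also have "\<dots> = (\<Sum>l\<in>I. a l)" by (simp add: sum_distrib_left sum_distrib_right a_def)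
  also have "\<dots> = a j + (\<Sum>l\<in>J. a l)" unfolding J_def by (rule sum.remove) (use assms in auto)
  also have "a j = p j" by (simp add: a_def pj)
  finally have sum0: "(\<Sum>l\<in>J. a l) = 0" by simp
  have a1: "norm (1 - a l) \<le> 1" if "l \<in> I" for l
    unfolding a_def using assms that by (intro norm_1_minus_compression_le_1) auto
  define N where "N = real (card J)"
  have N: "N \<ge> 1" using fin by (auto simp: N_def card_gt_0_iff Suc_le_eq)
  have sa: "star (a i) = a i" by (simp add: a_def star_mult pj pi mult.assoc)
  have "(\<Sum>l\<in>J - {i}. 1 - a l) = (N - 1) *\<^sub>R 1 + a i"
  proof -
    have "(\<Sum>l\<in>J. 1 - a l) = N *\<^sub>R 1" by (simp add: sum_subtractf sum0 N_def scaleR_conv_of_real)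
    then show ?thesis using fin by (simp add: sum_diff1 algebra_simps)
  qed
  then have "norm ((N - 1) *\<^sub>R 1 + a i) = norm (\<Sum>l\<in>J - {i}. 1 - a l)" by simp
  also have "\<dots> \<le> (\<Sum>l\<in>J - {i}. 1)"
    by (intro sum_norm_le a1) (auto simp: J_def)
  also have "\<dots> = N - 1" using fin N by (simp add: N_def of_nat_diff)
  finally have lower: "norm ((N - 1) *\<^sub>R 1 + a i) \<le> N - 1" .
  \<comment> \<open>\<open>N\<close> is chosen such that \<open>b = a i / N\<close> satisfies both \<open>\<parallel>1 + b\<parallel> \<le> 1\<close> and \<open>\<parallel>1 - b\<parallel> \<le> 1\<close>.\<close>
  have "norm (N *\<^sub>R 1 + a i) \<le> N"
    using lower norm_triangle_ineq[of "1::'a" "(N - 1) *\<^sub>R 1 + a i"] by (simp add: algebra_simps)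
  moreover have "norm (N *\<^sub>R 1 - a i) \<le> N"
  proof -
    have "N *\<^sub>R 1 - a i = (N - 1) *\<^sub>R 1 + (1 - a i)" by (simp add: algebra_simps)
    then have "norm (N *\<^sub>R 1 - a i) \<le> norm ((N - 1) *\<^sub>R (1::'a)) + norm (1 - a i)"
      by (simp only: norm_triangle_ineq)
    then show ?thesis using a1[OF \<open>i \<in> I\<close>] N by simp
  qed
  moreover define b where "b = (1 / N) *\<^sub>R a i"
  have b_eq: "1 + b = (1 / N) *\<^sub>R (N *\<^sub>R 1 + a i)" "1 - b = (1 / N) *\<^sub>R (N *\<^sub>R 1 - a i)"
    using N by (simp_all add: b_def algebra_simps)
  ultimately have "norm (1 + b) \<le> 1" "norm (1 - b) \<le> 1"
    using N unfolding b_eq by (simp_all del: scaleR_right_diff_distrib scaleR_add_right)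
  then have "b = 0"
    using sa by (intro selfadjoint_eq_0_if_norm_1_plus_minus_le_1) (auto simp: b_def)
  then have "a i = 0" using N by (simp add: b_def)
  moreover have "star (p i * p j) * (p i * p j) = a i"
    by (simp add: star_mult pj pi a_def) (metis mult.assoc pi(2))
  ultimately have "(norm (p i * p j))\<^sup>2 = 0" using cstar_identity[of "p i * p j"] by simp
  then show ?thesis by simp
qed

text \<open>For selfadjoint \<open>h\<close> with \<open>\<parallel>h\<parallel> < 1\<close> write \<open>1 - h\<^sup>2 = c\<^sup>2\<close>. Applying \<open>f\<close> to \<open>h\<^sup>2 + c\<^sup>2 = 1\<close> bounds
\<open>\<parallel>f h\<parallel>\<close> by \<open>1\<close>; scaling and the C*-identity give the general case.\<close>

lemma star_endomorphism_contractive: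
  fixes f :: "'a::cstar_algebra \<Rightarrow> 'a"
  assumes "unital_star_endomorphism f"
  shows "norm (f x) \<le> norm x"
proof -
  have f: "f (x + y) = f x + f y" "f (c *\<^sub>C x) = c *\<^sub>C f x" "f (x * y) = f x * f y"
      "f (star x) = star (f x)" "f 1 = 1" for x y c
    using assms by (auto simp: unital_star_endomorphism_def)
  have small: "norm (f h) \<le> 1" if h: "star h = h" "norm h < 1" for h
  proof -
    have "norm (h * h) < 1"
      using h by (simp add: norm_square_selfadjoint power_less_one_iff)
    then obtain c where c: "star c = c" "c * c = 1 - h * h"
        "\<And>z. z * (h * h) = (h * h) * z \<Longrightarrow> z * c = c * z"
      using selfadjoint_sqrt[of "h * h"] h by (metis star_mult)
    have "(norm (f h))\<^sup>2 \<le> norm (f h * f h + f c * f c)"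
      by (rule norm_le_norm_sum_squares) (simp_all add: h c flip: f(3,4), metis c(3) mult.assoc)
    also have "f h * f h + f c * f c = f (h * h + c * c)" by (simp add: f)
    also have "\<dots> = 1" by (simp add: c f)
    finally show ?thesis using power_le_one_iff[of "norm (f h)" 2] by simp
  qed
  have sa: "norm (f h) \<le> norm h" if h: "star h = h" for h
  proof (rule ccontr)
    assume "\<not> norm (f h) \<le> norm h"
    then obtain r where r: "norm h < r" "r < norm (f h)" using dense[of "norm h" "norm (f h)"] by (auto simp: not_le)
    then have "r > 0" using norm_ge_zero[of h] by linarith
    have "norm (f (complex_of_real (1 / r) *\<^sub>C h)) \<le> 1"
      using r \<open>r > 0\<close> by (intro small) (auto simp: star_scaleC h norm_scaleC norm_divide field_simps)
    then show False using r \<open>r > 0\<close> by (simp add: f norm_scaleC norm_divide field_simps)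
  qed
  have "(norm (f x))\<^sup>2 = norm (f (star x * x))" by (simp add: f cstar_identity)
  also have "\<dots> \<le> norm (star x * x)" by (rule sa) (simp add: star_mult star_star)
  also have "\<dots> = (norm x)\<^sup>2" by (rule cstar_identity)
  finally show ?thesis by (rule power2_le_imp_le) simp
qed

lemma subspace_commutant: "cvec.subspace (commutant Y)"
  by (auto simp: commutant_def cvec.subspace_def distrib_left distrib_right mult_scaleC_left mult_scaleC_right)

lemma cstar_subalgebra_commutant:
  assumes "\<And>x. x \<in> X \<Longrightarrow> star x \<in> X"
  shows "cstar_subalgebra (commutant X)"
proof -
  have "closed (commutant X)"
  proof -
    have "commutant X = (\<Inter>y\<in>X. {x. x * y = y * x})" by (auto simp: commutant_def)
    also have "closed \<dots>" by (intro closed_INT ballI closed_Collect_eq continuous_intros)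
    finally show ?thesis .
  qed
  moreover have "x * y \<in> commutant X" if "x \<in> commutant X" "y \<in> commutant X" for x y
    using that by (simp add: commutant_def) (metis mult.assoc)
  moreover have "star x \<in> commutant X" if "x \<in> commutant X" for x
    using that assms by (simp add: commutant_def) (metis star_mult star_star)
  ultimately show ?thesis using subspace_commutant by (simp add: cstar_subalgebra_def)
qed

section \<open>Images of a subspace under words in linear maps\<close>

definition clinear :: "('a::cstar_algebra \<Rightarrow> 'a) \<Rightarrow> bool" where
  "clinear f \<longleftrightarrow> (\<forall>x y. f (x + y) = f x + f y) \<and> (\<forall>c x. f (c *\<^sub>C x) = c *\<^sub>C f x)"

lemma clinear_span_image:
  assumes "clinear f" "cvec.subspace T" "\<And>x. x \<in> G \<Longrightarrow> f x \<in> T" "x \<in> cvec.span G"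
  shows "f x \<in> T"
  using assms(4)
proof (induction rule: cvec.span_induct_alt)
  case base
  have "f 0 = f (0 *\<^sub>C 0)" by simp
  also have "\<dots> = 0 *\<^sub>C f 0" using assms(1) by (metis clinear_def)
  finally show ?case using assms(2) by (simp add: cvec.subspace_0)
next
  case (step c x y)
  then show ?case using assms(1,2,3) 
    by (auto simp: clinear_def intro: cvec.subspace_add cvec.subspace_scale)
qed

lemma clinear_diff: "clinear f \<Longrightarrow> f (x - y) = f x - f y"
  unfolding clinear_def by (metis diff_add_cancel eq_diff_eq)

text \<open>For the maps \<open>a i j\<close> and \<open>V = D (k - 1)\<close> this is \<open>(K\<^sup>*)\<^sup>r V K\<^sup>r\<close>.\<close>

primrec iterated_span :: "('a::cstar_algebra \<Rightarrow> 'a) set \<Rightarrow> 'a set \<Rightarrow> nat \<Rightarrow> 'a set" where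
  "iterated_span T V 0 = V"
| "iterated_span T V (Suc r) = cvec.span (\<Union>t\<in>T. t ` iterated_span T V r)"

lemma subspace_iterated_span: "cvec.subspace V \<Longrightarrow> cvec.subspace (iterated_span T V r)"
  by (cases r) auto

lemma iterated_span_image: "t \<in> T \<Longrightarrow> x \<in> iterated_span T V r \<Longrightarrow> t x \<in> iterated_span T V (Suc r)"
  by (auto intro!: cvec.span_base)

lemma iterated_span_Suc_subset:
  assumes "cvec.subspace V" "\<And>t. t \<in> T \<Longrightarrow> clinear t" "\<And>t x. t \<in> T \<Longrightarrow> x \<in> V \<Longrightarrow> t x \<in> V"
  shows "iterated_span T V (Suc r) \<subseteq> iterated_span T V r"
proof (induction r)
  case 0
  show ?case using assms by (simp, intro cvec.span_minimal) auto
next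
  case (Suc r)
  then show ?case by (simp only: iterated_span.simps) (intro cvec.span_mono UN_mono image_mono order.refl)
qed

lemma iterated_span_eq_span_words:
  assumes "cvec.subspace V" "\<And>t. t \<in> T \<Longrightarrow> clinear t"
  shows "iterated_span T V r =
    cvec.span {foldr (\<lambda>t y. t y) ts x | ts x. set ts \<subseteq> T \<and> length ts = r \<and> x \<in> V}"
    (is "_ = cvec.span (?W r)")
proof (induction r)
  case 0
  have "?W 0 = V" by auto
  then show ?case using assms(1) by (simp only: iterated_span.simps cvec.span_eq_iff[THEN iffD2])
next
  case (Suc r)
  have "t x \<in> cvec.span (?W (Suc r))" if "t \<in> T" "x \<in> iterated_span T V r" for t x
  proof (rule clinear_span_image[OF assms(2)[OF that(1)]])
    show "x \<in> cvec.span (?W r)" using that Suc by simp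
    show "t y \<in> cvec.span (?W (Suc r))" if "y \<in> ?W r" for y
    proof -
      from that obtain ts z where "y = foldr (\<lambda>t y. t y) ts z" "set ts \<subseteq> T" "length ts = r" "z \<in> V"
        by blast
      then show ?thesis
        using \<open>t \<in> T\<close> by (intro cvec.span_base CollectI exI[of _ "t # ts"] exI[of _ z]) simp
    qed
  qed simp
  moreover have "y \<in> (\<Union>t\<in>T. t ` iterated_span T V r)" if "y \<in> ?W (Suc r)" for y
  proof -
    from that obtain ts x where y: "y = foldr (\<lambda>t y. t y) ts x" "set ts \<subseteq> T" "length ts = Suc r" "x \<in> V"
      by blast
    then obtain t ts' where ts: "ts = t # ts'" by (auto simp: length_Suc_conv)
    have "foldr (\<lambda>t y. t y) ts' x \<in> iterated_span T V r"
      unfolding Suc using y ts by (intro cvec.span_base) auto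
    then show ?thesis using y ts by auto
  qed
  ultimately show ?case
    unfolding iterated_span.simps cvec.span_eq by (intro conjI subsetI) (blast, rule cvec.span_base)
qed

lemma subspace_eq_if_dim_eq:
  assumes "cvec.subspace X" "X \<subseteq> Y" "Y \<subseteq> cvec.span T" "finite T" "cvec.dim X = cvec.dim Y"
  shows "X = Y"
proof (rule ccontr)
  assume "X \<noteq> Y"
  then obtain y where y: "y \<in> Y" "y \<notin> X" using assms(2) by blast
  obtain B where B: "B \<subseteq> X" "cvec.independent B" "X \<subseteq> cvec.span B" "card B = cvec.dim X"
    using cvec.basis_exists by blast
  have "cvec.span B \<subseteq> X" using B assms(1) by (intro cvec.span_minimal)
  then have "cvec.independent (insert y B)" using B y by (intro cvec.independent_insertI) auto
  moreover have "insert y B \<subseteq> Y" using y B assms(2) by auto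
  ultimately obtain C where C: "insert y B \<subseteq> C" "C \<subseteq> Y" "cvec.independent C" "Y \<subseteq> cvec.span C"
    using cvec.maximal_independent_subset_extend by blast
  then have "finite C" using cvec.independent_span_bound[OF assms(4) C(3)] assms(3) by blast
  have "cvec.dim Y = card C"
    using C by (intro cvec.dim_unique[of C]) auto
  moreover have "card (insert y B) \<le> card C" using C \<open>finite C\<close> by (intro card_mono)
  moreover have "y \<notin> B" "finite B" using y B C \<open>finite C\<close> finite_subset by (auto intro: finite_subset)
  ultimately show False using B assms(5) by simp
qed

text \<open>A member of the chain with minimal dimension is contained in all the others.\<close>

lemma decreasing_subspaces_stabilize:
  fixes X :: "nat \<Rightarrow> 'a::cstar_algebra set"
  assumes "decseq X" "\<And>r. cvec.subspace (X r)" "X 0 \<subseteq> cvec.span T" "finite T"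
  obtains r where "(\<Inter>s. X s) = X r"
proof -
  obtain r where r: "\<And>s. cvec.dim (X r) \<le> cvec.dim (X s)"
    using exists_least_iff[of "\<lambda>d. \<exists>r. d = cvec.dim (X r)"] by (metis le_less_linear)
  have sub: "X s \<subseteq> cvec.span T" for s
    using decseqD[OF assms(1), of 0 s] assms(3) by auto
  have "X (r + s) = X r" for s
  proof (rule subspace_eq_if_dim_eq[OF assms(2) decseqD[OF assms(1)] sub assms(4)])
    have "cvec.dim (X (r + s)) \<le> cvec.dim (X r)"
    proof -
      obtain B where B: "B \<subseteq> X (r + s)" "cvec.independent B" "X (r + s) \<subseteq> cvec.span B" "card B = cvec.dim (X (r + s))"
        using cvec.basis_exists by blast
      have "B \<subseteq> X r" using B(1) decseqD[OF assms(1), of r "r + s"] by auto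
      then obtain C where C: "B \<subseteq> C" "C \<subseteq> X r" "cvec.independent C" "X r \<subseteq> cvec.span C"
        using B(2) by (rule cvec.maximal_independent_subset_extend)
      then have "finite C" using cvec.independent_span_bound[OF assms(4) C(3)] sub by blast
      moreover have "cvec.dim (X r) = card C" using C by (intro cvec.dim_unique[of C]) auto
      ultimately show ?thesis using B C by (metis card_mono)
    qed
    then show "cvec.dim (X (r + s)) = cvec.dim (X r)" using r by (simp add: le_antisym)
  qed simp
  moreover have "X r \<subseteq> X s" for s
  proof (cases "r \<le> s")
    case True
    then show ?thesis using calculation[of "s - r"] by simp
  next
    case False
    then show ?thesis using decseqD[OF assms(1), of s r] by simp
  qed
  ultimately show thesis by (intro that[of r]) blast
qed

section \<open>Nilpotent rings of maps on a quotient space\<close>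

locale quotient_by_subspace =
  fixes V U :: "'a::cstar_algebra set"
  assumes V: "cvec.subspace V" and U: "cvec.subspace U"
begin

abbreviation coset :: "'a \<Rightarrow> 'a set" where "coset x \<equiv> x +o U"

abbreviation R where "R \<equiv> quot_End V U"

lemma mem_coset: "y \<in> coset x \<longleftrightarrow> y - x \<in> U"
  by (auto simp: elt_set_plus_def) (metis add_diff_cancel_left' diff_add_cancel add.commute)

lemma coset_eq_iff: "coset x = coset y \<longleftrightarrow> x - y \<in> U"
proof
  assume "coset x = coset y"
  moreover have "x \<in> coset x" using cvec.subspace_0[OF U] by (simp add: mem_coset)
  ultimately show "x - y \<in> U" by (simp add: mem_coset)
next
  assume xy: "x - y \<in> U"
  have "z - x \<in> U \<longleftrightarrow> z - y \<in> U" for z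
  proof
    assume "z - x \<in> U"
    then show "z - y \<in> U" using cvec.subspace_add[OF U _ xy] by force
  next
    assume "z - y \<in> U"
    then show "z - x \<in> U" using cvec.subspace_diff[OF U _ xy] by force
  qed
  then show "coset x = coset y" by (auto simp: mem_coset)
qed

lemma coset_0: "coset 0 = U"
  by (simp add: elt_set_plus_def)

lemma coset_eq_U_iff: "coset x = U \<longleftrightarrow> x \<in> U"
  using coset_eq_iff[of x 0] by (simp add: coset_0)

lemma coset_add: "coset x + coset y = coset (x + y)"
proof -
  have "U + U = U" using U by (auto simp: set_plus_def cvec.subspace_add)
     (metis U add.right_neutral cvec.subspace_0)
  then show ?thesis by (simp add: set_plus_rearrange)
qed

lemma quot_scale_coset: "quot_scale U c (coset x) = coset (c *\<^sub>C x)"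
proof (intro equalityI subsetI)
  fix z assume "z \<in> quot_scale U c (coset x)"
  then obtain u v where "u \<in> U" "v \<in> U" "z = c *\<^sub>C (x + u) + v"
    by (auto simp: quot_scale_def set_plus_def elt_set_plus_def)
  then show "z \<in> coset (c *\<^sub>C x)"
    using U by (simp add: mem_coset scaleC_add_right cvec.subspace_add cvec.subspace_scale)
next
  fix z assume "z \<in> coset (c *\<^sub>C x)"
  then have "z - c *\<^sub>C x \<in> U" by (simp add: mem_coset)
  moreover have "z = c *\<^sub>C x + (z - c *\<^sub>C x)" by simp
  moreover have "c *\<^sub>C x \<in> (\<lambda>x. c *\<^sub>C x) ` coset x"
    using cvec.subspace_0[OF U] by (auto simp: mem_coset)
  ultimately show "z \<in> quot_scale U c (coset x)"
    unfolding quot_scale_def using set_plus_intro by metis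
qed

text \<open>An endomorphism of the quotient is handled through a map \<open>g\<close> on representatives, which is
linear only modulo \<open>U\<close>. This rule and its converse \<open>quot_EndE\<close> turn ring identities
between maps on cosets into membership in \<open>U\<close>.\<close>

lemma quot_EndI:
  assumes "f \<in> extensional (quot_space V U)" "\<And>x. x \<in> V \<Longrightarrow> g x \<in> V"
    and "\<And>x. x \<in> V \<Longrightarrow> f (coset x) = coset (g x)"
    and "\<And>x y. x \<in> V \<Longrightarrow> y \<in> V \<Longrightarrow> g (x + y) - (g x + g y) \<in> U"
    and "\<And>c x. x \<in> V \<Longrightarrow> g (c *\<^sub>C x) - c *\<^sub>C g x \<in> U"
  shows "f \<in> carrier R"
  using assms V
  by (auto simp: quot_End_def PiE_def quot_space_def coset_add quot_scale_coset coset_eq_iff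
      cvec.subspace_add cvec.subspace_scale)

lemma quot_EndE:
  assumes "f \<in> carrier R"
  obtains g where "f \<in> extensional (quot_space V U)" "\<And>x. x \<in> V \<Longrightarrow> g x \<in> V"
    "\<And>x. x \<in> V \<Longrightarrow> f (coset x) = coset (g x)"
    "\<And>x y. x \<in> V \<Longrightarrow> y \<in> V \<Longrightarrow> g (x + y) - (g x + g y) \<in> U"
    "\<And>c x. x \<in> V \<Longrightarrow> g (c *\<^sub>C x) - c *\<^sub>C g x \<in> U"
proof -
  have "\<forall>x\<in>V. \<exists>y\<in>V. f (coset x) = coset y"
    using assms by (fastforce simp: quot_End_def quot_space_def PiE_def Pi_def)
  then obtain g where g: "\<And>x. x \<in> V \<Longrightarrow> g x \<in> V" "\<And>x. x \<in> V \<Longrightarrow> f (coset x) = coset (g x)"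
    by metis
  show thesis
  proof (rule that[OF _ g])
    show "f \<in> extensional (quot_space V U)" using assms by (auto simp: quot_End_def PiE_def)
    show "g (x + y) - (g x + g y) \<in> U" if "x \<in> V" "y \<in> V" for x y
    proof -
      have "f (coset x + coset y) = f (coset x) + f (coset y)"
        using assms that by (auto simp: quot_End_def quot_space_def)
      then show ?thesis using that g V by (simp add: coset_add cvec.subspace_add flip: coset_eq_iff)
    qed
    show "g (c *\<^sub>C x) - c *\<^sub>C g x \<in> U" if "x \<in> V" for c x
    proof -
      have "f (quot_scale U c (coset x)) = quot_scale U c (f (coset x))"
        using assms that by (auto simp: quot_End_def quot_space_def)
      then show ?thesis using that g V by (simp add: quot_scale_coset cvec.subspace_scale flip: coset_eq_iff)
    qed
  qed
qed

lemma quot_End_eqI: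
  assumes "f \<in> carrier R" "g \<in> carrier R" "\<And>x. x \<in> V \<Longrightarrow> f (coset x) = g (coset x)"
  shows "f = g"
  by (rule extensionalityI[where A = "quot_space V U"])
     (use assms in \<open>auto simp: quot_End_def PiE_def quot_space_def\<close>)

lemma quot_End_apply [simp]:
  assumes "x \<in> V"
  shows "(f \<otimes>\<^bsub>R\<^esub> g) (coset x) = f (g (coset x))" "(f \<oplus>\<^bsub>R\<^esub> g) (coset x) = f (coset x) + g (coset x)"
    "\<zero>\<^bsub>R\<^esub> (coset x) = U" "\<one>\<^bsub>R\<^esub> (coset x) = coset x"
  using assms by (auto simp: quot_End_def quot_space_def compose_def)

lemma zero_in_R: "\<zero>\<^bsub>R\<^esub> \<in> carrier R"
  by (rule quot_EndI[where g = "\<lambda>x. 0"])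
     (use V U in \<open>auto simp: quot_End_def quot_space_def coset_0 cvec.subspace_0\<close>)

lemma one_in_R: "\<one>\<^bsub>R\<^esub> \<in> carrier R"
  by (rule quot_EndI[where g = "\<lambda>x. x"])
     (use V U in \<open>auto simp: quot_End_def quot_space_def cvec.subspace_0\<close>)

lemma add_in_R:
  assumes "f \<in> carrier R" "h \<in> carrier R" shows "f \<oplus>\<^bsub>R\<^esub> h \<in> carrier R"
proof -
  from quot_EndE[OF assms(1)] obtain f' where f: "\<And>x. x \<in> V \<Longrightarrow> f' x \<in> V"
    "\<And>x. x \<in> V \<Longrightarrow> f (coset x) = coset (f' x)"
    "\<And>x y. x \<in> V \<Longrightarrow> y \<in> V \<Longrightarrow> f' (x + y) - (f' x + f' y) \<in> U"
    "\<And>c x. x \<in> V \<Longrightarrow> f' (c *\<^sub>C x) - c *\<^sub>C f' x \<in> U" by metis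
  from quot_EndE[OF assms(2)] obtain h' where h: "\<And>x. x \<in> V \<Longrightarrow> h' x \<in> V"
    "\<And>x. x \<in> V \<Longrightarrow> h (coset x) = coset (h' x)"
    "\<And>x y. x \<in> V \<Longrightarrow> y \<in> V \<Longrightarrow> h' (x + y) - (h' x + h' y) \<in> U"
    "\<And>c x. x \<in> V \<Longrightarrow> h' (c *\<^sub>C x) - c *\<^sub>C h' x \<in> U" by metis
  show ?thesis
  proof (rule quot_EndI[where g = "\<lambda>x. f' x + h' x"])
    show "f \<oplus>\<^bsub>R\<^esub> h \<in> extensional (quot_space V U)" by (simp add: quot_End_def)
    show "f' x + h' x \<in> V" if "x \<in> V" for x using V f(1) h(1) that by (simp add: cvec.subspace_add)
    show "(f \<oplus>\<^bsub>R\<^esub> h) (coset x) = coset (f' x + h' x)" if "x \<in> V" for x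
      using that f(2) h(2) by (simp add: coset_add)
    show "f' (x + y) + h' (x + y) - (f' x + h' x + (f' y + h' y)) \<in> U" if "x \<in> V" "y \<in> V" for x y
      using cvec.subspace_add[OF U f(3)[OF that] h(3)[OF that]] by (simp add: algebra_simps)
    show "f' (c *\<^sub>C x) + h' (c *\<^sub>C x) - c *\<^sub>C (f' x + h' x) \<in> U" if "x \<in> V" for c x
      using cvec.subspace_add[OF U f(4)[OF that] h(4)[OF that]] by (simp add: algebra_simps scaleC_add_right)
  qed
qed

lemma mult_in_R:
  assumes "f \<in> carrier R" "h \<in> carrier R" shows "f \<otimes>\<^bsub>R\<^esub> h \<in> carrier R"
proof -
  have f: "f \<in> quot_space V U \<rightarrow> quot_space V U"
      "\<And>X Y. X \<in> quot_space V U \<Longrightarrow> Y \<in> quot_space V U \<Longrightarrow> f (X + Y) = f X + f Y"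
      "\<And>c X. X \<in> quot_space V U \<Longrightarrow> f (quot_scale U c X) = quot_scale U c (f X)"
    and h: "h \<in> quot_space V U \<rightarrow> quot_space V U"
      "\<And>X Y. X \<in> quot_space V U \<Longrightarrow> Y \<in> quot_space V U \<Longrightarrow> h (X + Y) = h X + h Y"
      "\<And>c X. X \<in> quot_space V U \<Longrightarrow> h (quot_scale U c X) = quot_scale U c (h X)"
    using assms by (auto simp: quot_End_def PiE_def)
  have "X + Y \<in> quot_space V U" if "X \<in> quot_space V U" "Y \<in> quot_space V U" for X Y
    using that V by (auto simp: quot_space_def coset_add cvec.subspace_add)
  moreover have "quot_scale U c X \<in> quot_space V U" if "X \<in> quot_space V U" for c X
    using that V by (auto simp: quot_space_def quot_scale_coset cvec.subspace_scale)
  ultimately show ?thesis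
    using f h by (auto simp: quot_End_def compose_def Pi_def)
qed

lemma abelian_group_R: "abelian_group R"
proof (rule abelian_groupI)
  fix f assume f: "f \<in> carrier R"
  from quot_EndE[OF f] obtain f' where f': "\<And>x. x \<in> V \<Longrightarrow> f' x \<in> V"
    "\<And>x. x \<in> V \<Longrightarrow> f (coset x) = coset (f' x)"
    "\<And>x y. x \<in> V \<Longrightarrow> y \<in> V \<Longrightarrow> f' (x + y) - (f' x + f' y) \<in> U"
    "\<And>c x. x \<in> V \<Longrightarrow> f' (c *\<^sub>C x) - c *\<^sub>C f' x \<in> U" by metis
  show "\<zero>\<^bsub>R\<^esub> \<oplus>\<^bsub>R\<^esub> f = f"
  proof (rule quot_End_eqI)
    fix x assume "x \<in> V"
    then show "(\<zero>\<^bsub>R\<^esub> \<oplus>\<^bsub>R\<^esub> f) (coset x) = f (coset x)"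
      using coset_add[of 0] by (simp add: f'(2) coset_0)
  qed (use f in \<open>auto intro: add_in_R zero_in_R\<close>)
  define g where "g = (\<lambda>X\<in>quot_space V U. quot_scale U (-1) (f X))"
  have g_coset: "g (coset x) = coset (- f' x)" if "x \<in> V" for x
    using that f'(2) cvec.scale_minus_left[of 1] by (auto simp: g_def quot_space_def quot_scale_coset scaleC_one)
  have "g \<in> carrier R"
  proof (rule quot_EndI[where g = "\<lambda>x. - f' x"])
    show "g \<in> extensional (quot_space V U)" by (simp add: g_def)
    show "- f' x \<in> V" if "x \<in> V" for x using f'(1) that V by (simp add: cvec.subspace_neg)
    show "- f' (x + y) - (- f' x + - f' y) \<in> U" if "x \<in> V" "y \<in> V" for x y
      using cvec.subspace_neg[OF U f'(3)[OF that]] by (simp add: algebra_simps)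
    show "- f' (c *\<^sub>C x) - c *\<^sub>C - f' x \<in> U" if "x \<in> V" for c x
      using cvec.subspace_neg[OF U f'(4)[OF that]] by (simp add: algebra_simps)
  qed (rule g_coset)
  moreover have "g \<oplus>\<^bsub>R\<^esub> f = \<zero>\<^bsub>R\<^esub>"
    by (rule quot_End_eqI)
       (use f \<open>g \<in> carrier R\<close> in \<open>auto intro!: add_in_R zero_in_R simp: g_coset f'(2) coset_add coset_0\<close>)
  ultimately show "\<exists>g\<in>carrier R. g \<oplus>\<^bsub>R\<^esub> f = \<zero>\<^bsub>R\<^esub>" by blast
next
  fix f g h assume "f \<in> carrier R" "g \<in> carrier R" "h \<in> carrier R"
  then show "f \<oplus>\<^bsub>R\<^esub> g \<oplus>\<^bsub>R\<^esub> h = f \<oplus>\<^bsub>R\<^esub> (g \<oplus>\<^bsub>R\<^esub> h)"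
    by (intro quot_End_eqI add_in_R) (simp_all add: add.assoc)
next
  fix f g assume "f \<in> carrier R" "g \<in> carrier R"
  then show "f \<oplus>\<^bsub>R\<^esub> g = g \<oplus>\<^bsub>R\<^esub> f"
    by (intro quot_End_eqI add_in_R) (simp_all add: add.commute)
qed (intro add_in_R zero_in_R; assumption)+

lemma a_inv_coset:
  assumes "f \<in> carrier R" "x \<in> V" "y \<in> V" "f (coset x) = coset y"
  shows "(\<ominus>\<^bsub>R\<^esub> f) (coset x) = coset (- y)"
proof -
  interpret abelian_group R by (rule abelian_group_R)
  have "\<ominus>\<^bsub>R\<^esub> f \<in> carrier R" using assms by simp
  then obtain z where z: "(\<ominus>\<^bsub>R\<^esub> f) (coset x) = coset z" using assms(2) by (metis quot_EndE)
  have "(\<ominus>\<^bsub>R\<^esub> f \<oplus>\<^bsub>R\<^esub> f) (coset x) = U" using assms by (simp only: l_neg quot_End_apply)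
  then have "coset (z + y) = U" using assms z by (simp add: coset_add)
  then show ?thesis using z by (simp add: coset_eq_iff coset_eq_U_iff)
qed

lemma quot_map_coset:
  assumes "x \<in> V" "clinear f" "\<And>u. u \<in> U \<Longrightarrow> f u \<in> U"
  shows "quot_map V U f (coset x) = coset (f x)"
proof -
  have "coset (f y) = coset (f x)" if "y \<in> coset x" for y
    using assms that by (simp add: coset_eq_iff mem_coset flip: clinear_diff)
  moreover have "x \<in> coset x" using cvec.subspace_0[OF U] by (simp add: mem_coset)
  ultimately have "(\<lambda>y. coset (f y)) ` coset x = {coset (f x)}" by blast
  then show ?thesis using assms(1) by (simp add: quot_map_def quot_space_def)
qed

lemma quot_map_in_R:
  assumes "clinear f" "\<And>u. u \<in> U \<Longrightarrow> f u \<in> U" "\<And>v. v \<in> V \<Longrightarrow> f v \<in> V"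
  shows "quot_map V U f \<in> carrier R"
proof (rule quot_EndI[where g = f])
  show "quot_map V U f \<in> extensional (quot_space V U)" by (simp add: quot_map_def)
qed (use assms cvec.subspace_0[OF U] in \<open>auto simp: quot_map_coset\<close>, auto simp: clinear_def)

text \<open>The images of \<open>iterated_span T V r\<close> in the quotient form a filtration. The generators raise
its degree by one, a property inherited by sums, negatives and products, hence by the whole ring;
so a product of \<open>m\<close> elements maps the quotient into the image of \<open>iterated_span T V m\<close>.
Conversely, if all products of \<open>m\<close> generators vanish, then the \<open>m\<close>-fold composites of elements of
\<open>T\<close>, which span \<open>iterated_span T V m\<close>, take values in \<open>U\<close>.\<close>

lemma nilpotent_generate_rng_iff:
  assumes T: "\<And>t. t \<in> T \<Longrightarrow> clinear t" "\<And>t u. t \<in> T \<Longrightarrow> u \<in> U \<Longrightarrow> t u \<in> U"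
      "\<And>t v. t \<in> T \<Longrightarrow> v \<in> V \<Longrightarrow> t v \<in> V"
  shows "nilpotent_rng R (generate_rng R (quot_map V U ` T)) \<longleftrightarrow> (\<exists>m\<ge>1. iterated_span T V m \<subseteq> U)"
proof -
  interpret abelian_group R by (rule abelian_group_R)
  let ?A = "generate_rng R (quot_map V U ` T)"
  let ?X = "iterated_span T V"
  have dec: "?X (Suc r) \<subseteq> ?X r" for r
    using V T(1,3) by (rule iterated_span_Suc_subset)
  have XV: "?X r \<subseteq> V" for r
    by (induction r) (use dec in \<open>auto simp del: iterated_span.simps(2)\<close>)
  have subX: "cvec.subspace (?X r)" for r using V by (rule subspace_iterated_span)
  have A: "f \<in> carrier R \<and> (\<forall>r. \<forall>x\<in>?X r. \<exists>y\<in>?X (Suc r). f (coset x) = coset y)" if "f \<in> ?A" for f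
    using that
  proof induction
    case zero
    have "\<zero>\<^bsub>R\<^esub> (coset x) = coset 0" if "x \<in> ?X r" for x r
      using that XV[of r] by (simp add: subset_iff coset_0)
    then show ?case using zero_in_R cvec.subspace_0[OF subX] by blast
  next
    case (incl h)
    then obtain t where t: "t \<in> T" "h = quot_map V U t" by auto
    have "h (coset x) = coset (t x)" if "x \<in> ?X r" for x r
      unfolding t(2) by (rule quot_map_coset) (use t(1) XV that T in blast)+
    moreover have "h \<in> carrier R" using t T by (auto intro: quot_map_in_R)
    ultimately show ?case using t(1) iterated_span_image by blast
  next
    case (a_inv h)
    have "(\<ominus>\<^bsub>R\<^esub> h) (coset x) = coset (- y)" if "x \<in> ?X r" "y \<in> ?X (Suc r)" "h (coset x) = coset y" for x y r
      using a_inv that XV by (intro a_inv_coset) blast+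
    then show ?case using a_inv cvec.subspace_neg[OF subX] by (metis a_inv_closed)
  next
    case (add f g)
    have "(f \<oplus>\<^bsub>R\<^esub> g) (coset x) = coset (y + z)"
      if "x \<in> ?X r" "f (coset x) = coset y" "g (coset x) = coset z" for x y z r
      using that XV[of r] by (simp add: subset_iff coset_add)
    then show ?case using add cvec.subspace_add[OF subX] by (metis a_closed)
  next
    case (mult f g)
    have "\<exists>y\<in>?X (Suc r). (f \<otimes>\<^bsub>R\<^esub> g) (coset x) = coset y" if x: "x \<in> ?X r" for x r
    proof -
      obtain y where y: "y \<in> ?X (Suc r)" "g (coset x) = coset y" using mult x by blast
      then obtain z where "z \<in> ?X (Suc r)" "f (coset y) = coset z"
        using mult dec by (meson subsetD)
      then show ?thesis using y x XV[of r] by (auto simp: subset_iff)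
    qed
    then show ?case using mult mult_in_R by blast
  qed
  show ?thesis
  proof
    assume "nilpotent_rng R ?A"
    then obtain m where m: "m \<ge> 1" "rng_power R ?A m = {\<zero>\<^bsub>R\<^esub>}" by (auto simp: nilpotent_rng_def)
    have "foldr (\<lambda>t y. t y) ts x \<in> U" if ts: "set ts \<subseteq> T" "length ts = m" "x \<in> V" for ts x
    proof -
      have ev: "foldr (mult R) (map (quot_map V U) ts) \<one>\<^bsub>R\<^esub> (coset x) = coset (foldr (\<lambda>t y. t y) ts x)
          \<and> foldr (\<lambda>t y. t y) ts x \<in> V" if "set ts \<subseteq> T" for ts
        using that by (induction ts) (use ts(3) T in \<open>auto simp: quot_map_coset\<close>)
      have "foldr (mult R) (map (quot_map V U) ts) \<one>\<^bsub>R\<^esub> \<in> rng_power R ?A m"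
        unfolding rng_power_def
        by (intro generate.incl CollectI exI[of _ "map (quot_map V U) ts"])
           (use ts in \<open>auto intro: generate_rng.incl\<close>)
      then have "foldr (mult R) (map (quot_map V U) ts) \<one>\<^bsub>R\<^esub> = \<zero>\<^bsub>R\<^esub>" using m by simp
      then have "coset (foldr (\<lambda>t y. t y) ts x) = U"
        using ev[OF ts(1)] ts(3) by (metis quot_End_apply(3))
      then show ?thesis by (simp add: coset_eq_U_iff)
    qed
    then have "cvec.span {foldr (\<lambda>t y. t y) ts x | ts x. set ts \<subseteq> T \<and> length ts = m \<and> x \<in> V} \<subseteq> U"
      using U by (intro cvec.span_minimal) auto
    moreover have "?X m = cvec.span {foldr (\<lambda>t y. t y) ts x | ts x. set ts \<subseteq> T \<and> length ts = m \<and> x \<in> V}"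
      using V T(1) by (rule iterated_span_eq_span_words)
    ultimately have "?X m \<subseteq> U" by simp
    then show "\<exists>m\<ge>1. ?X m \<subseteq> U" using m by blast
  next
    assume "\<exists>m\<ge>1. ?X m \<subseteq> U"
    then obtain m where m: "m \<ge> 1" "?X m \<subseteq> U" by blast
    have words: "foldr (mult R) fs \<one>\<^bsub>R\<^esub> \<in> carrier R \<and>
        (\<forall>x\<in>V. \<exists>y\<in>?X (length fs). foldr (mult R) fs \<one>\<^bsub>R\<^esub> (coset x) = coset y)"
      if "set fs \<subseteq> ?A" for fs
      using that
    proof (induction fs)
      case Nil
      then show ?case using one_in_R by auto
    next
      case (Cons f fs)
      then have fs_A: "set fs \<subseteq> ?A" by simp
      from Cons have f: "f \<in> carrier R" "\<And>r x. x \<in> ?X r \<Longrightarrow> \<exists>y\<in>?X (Suc r). f (coset x) = coset y"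
        using A by auto
      have "\<exists>y\<in>?X (Suc (length fs)). foldr (mult R) (f # fs) \<one>\<^bsub>R\<^esub> (coset x) = coset y" if "x \<in> V" for x
      proof -
        obtain y where "y \<in> ?X (length fs)" "foldr (mult R) fs \<one>\<^bsub>R\<^esub> (coset x) = coset y"
          using Cons.IH fs_A \<open>x \<in> V\<close> by blast
        then show ?thesis using f(2) that by simp
      qed
      then show ?case using Cons f(1) by (simp add: mult_in_R)
    qed
    have zero: "foldr (mult R) fs \<one>\<^bsub>R\<^esub> = \<zero>\<^bsub>R\<^esub>" if fs: "set fs \<subseteq> ?A" "length fs = m" for fs
    proof (rule quot_End_eqI)
      fix x assume "x \<in> V"
      then obtain y where "y \<in> ?X m" "foldr (mult R) fs \<one>\<^bsub>R\<^esub> (coset x) = coset y"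
        using words[OF fs(1)] fs(2) by auto
      then show "foldr (mult R) fs \<one>\<^bsub>R\<^esub> (coset x) = \<zero>\<^bsub>R\<^esub> (coset x)"
        using m(2) \<open>x \<in> V\<close> by (auto simp: coset_eq_U_iff)
    qed (use words fs zero_in_R in auto)
    have "h = \<zero>\<^bsub>R\<^esub>" if "h \<in> rng_power R ?A m" for h
      using that unfolding rng_power_def
    proof induction
      case (inv h)
      then have "h = \<zero>\<^bsub>R\<^esub>" using zero by auto
      then show ?case using monoid.inv_one[OF group.is_monoid[OF a_group]] by simp
    next
      case (eng h1 h2)
      then show ?case by simp
    qed (use zero in auto)
    moreover have "\<zero>\<^bsub>R\<^esub> \<in> rng_power R ?A m"
      unfolding rng_power_def using generate.one[of "add_monoid R"] by simp
    ultimately show "nilpotent_rng R ?A" using m(1) unfolding nilpotent_rng_def by blast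
  qed
qed

end

section \<open>The Cuntz relations\<close>

lemma words_0: "words n 0 = {[]}"
  by (auto simp: words_def)

lemma words_Suc: "words n (Suc k) = (\<lambda>(i, \<alpha>). i # \<alpha>) ` ({1..n} \<times> words n k)"
  by (auto simp: words_def length_Suc_conv image_iff)

lemma finite_words: "finite (words n k)"
  by (induction k) (auto simp: words_0 words_Suc)

lemma words_append: "\<alpha> \<in> words n k \<Longrightarrow> \<beta> \<in> words n l \<Longrightarrow> \<alpha> @ \<beta> \<in> words n (k + l)"
  by (auto simp: words_def)

lemma S_word_simps [simp]:
  "S_word S [] = 1" "S_word S (i # \<alpha>) = S i * S_word S \<alpha>" "S_word S (\<alpha> @ \<beta>) = S_word S \<alpha> * S_word S \<beta>"
  by (simp_all add: S_word_def)

locale cuntz =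
  fixes n :: nat and S :: "nat \<Rightarrow> 'a::cstar_algebra"
  assumes cuntz: "cuntz_generators n S"
begin

lemma S_isometry: "i \<in> {1..n} \<Longrightarrow> star (S i) * S i = 1"
  using cuntz by (simp add: cuntz_generators_def)

lemma S_complete: "(\<Sum>i=1..n. S i * star (S i)) = 1"
  using cuntz by (simp add: cuntz_generators_def)

lemma S_orthogonal:
  assumes "i \<in> {1..n}" "j \<in> {1..n}" "i \<noteq> j"
  shows "star (S i) * S j = 0"
proof -
  have "(S i * star (S i)) * (S j * star (S j)) = 0"
  proof (rule projections_with_sum_1_orthogonal[OF _ _ S_complete assms])
    fix l assume "l \<in> {1..n}"
    then have "S l * (star (S l) * S l) * star (S l) = S l * star (S l)"
      using S_isometry by simp
    then show "projection (S l * star (S l))"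
      by (simp add: projection_def star_mult star_star mult.assoc)
  qed simp
  moreover have "star (S i) * S j = (star (S i) * S i) * (star (S i) * S j) * (star (S j) * S j)"
    using assms S_isometry by simp
  then have "star (S i) * S j = star (S i) * ((S i * star (S i)) * (S j * star (S j))) * S j"
    by (simp add: mult.assoc)
  ultimately show ?thesis by simp
qed

lemma star_S_mult_S:
  "i \<in> {1..n} \<Longrightarrow> j \<in> {1..n} \<Longrightarrow> star (S i) * S j = (if i = j then 1 else 0)"
  using S_isometry S_orthogonal by simp

lemma star_S_mult_S_mult:
  "i \<in> {1..n} \<Longrightarrow> j \<in> {1..n} \<Longrightarrow> star (S i) * (S j * x) = (if i = j then x else 0)"
  using star_S_mult_S[of i j] by (simp flip: mult.assoc)

lemma star_S_word_mult_S_word: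
  "\<alpha> \<in> words n k \<Longrightarrow> \<beta> \<in> words n k \<Longrightarrow>
    star (S_word S \<alpha>) * S_word S \<beta> = (if \<alpha> = \<beta> then 1 else 0)"
proof (induction k arbitrary: \<alpha> \<beta>)
  case 0
  then show ?case by (simp add: words_0)
next
  case (Suc k)
  then obtain i j \<alpha>' \<beta>' where eq: "\<alpha> = i # \<alpha>'" "\<beta> = j # \<beta>'" "i \<in> {1..n}" "j \<in> {1..n}"
    "\<alpha>' \<in> words n k" "\<beta>' \<in> words n k" by (auto simp: words_Suc)
  then show ?case
    using Suc.IH[of \<alpha>' \<beta>'] by (auto simp: star_mult mult.assoc star_S_mult_S_mult)
qed

lemma S_word_complete: "(\<Sum>\<alpha>\<in>words n k. S_word S \<alpha> * star (S_word S \<alpha>)) = 1"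
proof (induction k)
  case 0
  then show ?case by (simp add: words_0)
next
  case (Suc k)
  have "(\<Sum>\<alpha>\<in>words n (Suc k). S_word S \<alpha> * star (S_word S \<alpha>))
      = (\<Sum>(i, \<alpha>)\<in>{1..n} \<times> words n k. S i * (S_word S \<alpha> * star (S_word S \<alpha>)) * star (S i))"
    unfolding words_Suc
    by (subst sum.reindex) (auto simp: inj_on_def star_mult mult.assoc case_prod_beta)
  also have "\<dots> = (\<Sum>i=1..n. S i * (\<Sum>\<alpha>\<in>words n k. S_word S \<alpha> * star (S_word S \<alpha>)) * star (S i))"
    by (simp add: sum.cartesian_product[symmetric] sum_distrib_left sum_distrib_right)
  finally show ?case using Suc S_complete by simp
qed

section \<open>The matrix algebras spanned by words of equal length\<close>

abbreviation F where "F k \<equiv> F_alg n S k"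

lemma F_I: "\<alpha> \<in> words n k \<Longrightarrow> \<beta> \<in> words n k \<Longrightarrow> S_word S \<alpha> * star (S_word S \<beta>) \<in> F k"
  unfolding F_alg_def by (intro cvec.span_base) blast

lemma subspace_F: "cvec.subspace (F k)"
  unfolding F_alg_def by simp

lemma F_image_subset:
  assumes "clinear f" "cvec.subspace T" "x \<in> F k"
    and "\<And>\<alpha> \<beta>. \<alpha> \<in> words n k \<Longrightarrow> \<beta> \<in> words n k \<Longrightarrow> f (S_word S \<alpha> * star (S_word S \<beta>)) \<in> T"
  shows "f x \<in> T"
  using assms(3) unfolding F_alg_def
  by (rule clinear_span_image[OF assms(1,2), rotated]) (use assms(4) in blast)

lemma clinear_mult [simp]: "clinear (\<lambda>x. a * x * b)" "clinear (\<lambda>x. a * x)" "clinear (\<lambda>x. x * b)"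
   "clinear (\<lambda>x. x)"
  by (simp_all add: clinear_def distrib_left distrib_right mult_scaleC_left mult_scaleC_right)

text \<open>Insert \<open>1 = \<Sum>i. S i (S i)\<^sup>*\<close> between \<open>S \<alpha>\<close> and \<open>(S \<beta>)\<^sup>*\<close>.\<close>

lemma F_Suc: "F k \<subseteq> F (Suc k)"
proof
  fix x assume "x \<in> F k"
  then show "x \<in> F (Suc k)"
  proof (rule F_image_subset[where f = "\<lambda>x. x", OF _ subspace_F, rotated])
    fix \<alpha> \<beta> assume w: "\<alpha> \<in> words n k" "\<beta> \<in> words n k"
    have "S_word S \<alpha> * star (S_word S \<beta>) = S_word S \<alpha> * (\<Sum>i=1..n. S i * star (S i)) * star (S_word S \<beta>)"
      unfolding S_complete by simp
    also have "\<dots> = (\<Sum>i=1..n. S_word S (\<alpha> @ [i]) * star (S_word S (\<beta> @ [i])))"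
      by (simp add: sum_distrib_left sum_distrib_right star_mult mult.assoc)
    also have "\<dots> \<in> F (Suc k)"
    proof (intro cvec.subspace_sum subspace_F F_I)
      fix i assume "i \<in> {1..n}"
      then have "[i] \<in> words n 1" by (simp add: words_def)
      then show "\<alpha> @ [i] \<in> words n (Suc k)" "\<beta> @ [i] \<in> words n (Suc k)"
        using w words_append by fastforce+
    qed
    finally show "S_word S \<alpha> * star (S_word S \<beta>) \<in> F (Suc k)" .
  qed simp
qed

lemma F_mono: "k \<le> l \<Longrightarrow> F k \<subseteq> F l"
  using F_Suc by (rule lift_Suc_mono_le)

lemma F_mult:
  assumes "x \<in> F k" "y \<in> F k"
  shows "x * y \<in> F k"
proof (rule F_image_subset[OF clinear_mult(3) subspace_F assms(1)])
  fix \<alpha> \<beta> assume w: "\<alpha> \<in> words n k" "\<beta> \<in> words n k"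
  show "S_word S \<alpha> * star (S_word S \<beta>) * y \<in> F k"
  proof (rule F_image_subset[OF clinear_mult(2) subspace_F assms(2)])
    fix \<gamma> \<delta> assume w': "\<gamma> \<in> words n k" "\<delta> \<in> words n k"
    have "S_word S \<alpha> * star (S_word S \<beta>) * (S_word S \<gamma> * star (S_word S \<delta>))
        = S_word S \<alpha> * (star (S_word S \<beta>) * S_word S \<gamma>) * star (S_word S \<delta>)"
      by (simp add: mult.assoc)
    then show "S_word S \<alpha> * star (S_word S \<beta>) * (S_word S \<gamma> * star (S_word S \<delta>)) \<in> F k"
      using w w' F_I by (simp add: star_S_word_mult_S_word cvec.subspace_0[OF subspace_F])
  qed
qed

lemma F_star: "x \<in> F k \<Longrightarrow> star x \<in> F k"
  unfolding F_alg_def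
proof (induction rule: cvec.span_induct_alt)
  case (step c x y)
  then have "star x \<in> F k" using F_I by (auto simp: star_mult star_star)
  then show ?case
    using step subspace_F[of k] unfolding star_add star_scaleC F_alg_def
    by (intro cvec.subspace_add cvec.subspace_scale)
qed (simp add: cvec.span_zero)

lemma F_0: "F 0 = cvec.span {1}"
  by (simp add: F_alg_def words_0)

lemma one_in_F: "1 \<in> F k"
  using F_mono[of 0 k] cvec.span_base[of 1 "{1}"] by (auto simp: F_0)

lemma star_S_F_S:
  assumes "x \<in> F (Suc k)" "i \<in> {1..n}" "j \<in> {1..n}"
  shows "star (S i) * x * S j \<in> F k"
proof (rule F_image_subset[OF _ subspace_F assms(1)])
  fix \<alpha> \<beta> assume "\<alpha> \<in> words n (Suc k)" "\<beta> \<in> words n (Suc k)"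
  then obtain a b \<alpha>' \<beta>' where eq: "\<alpha> = a # \<alpha>'" "\<beta> = b # \<beta>'" "a \<in> {1..n}" "b \<in> {1..n}"
    "\<alpha>' \<in> words n k" "\<beta>' \<in> words n k" by (auto simp: words_Suc)
  have "star (S i) * (S_word S \<alpha> * star (S_word S \<beta>)) * S j
      = (star (S i) * S a) * (S_word S \<alpha>' * star (S_word S \<beta>')) * (star (S b) * S j)"
    by (simp add: eq star_mult mult.assoc)
  then show "star (S i) * (S_word S \<alpha> * star (S_word S \<beta>)) * S j \<in> F k"
    using eq assms F_I by (simp add: star_S_mult_S cvec.subspace_0[OF subspace_F])
qed simp

lemma star_S_F_S_same: "x \<in> F k \<Longrightarrow> i \<in> {1..n} \<Longrightarrow> j \<in> {1..n} \<Longrightarrow> star (S i) * x * S j \<in> F k"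
  using star_S_F_S F_Suc by blast

section \<open>The diagonal and its finite levels\<close>

abbreviation D where "D k \<equiv> D_alg n S k"

lemma cstar_subalgebra_diagonal: "cstar_subalgebra (diagonal n S)"
  unfolding diagonal_def cstar_generated_def cstar_subalgebra_def
  by (auto intro: closed_Inter simp: cvec.subspace_def)

lemma subspace_diagonal: "cvec.subspace (diagonal n S)"
  using cstar_subalgebra_diagonal by (simp add: cstar_subalgebra_def)

lemma subspace_D: "cvec.subspace (D k)"
  unfolding D_alg_def by (intro cvec.subspace_inter subspace_diagonal subspace_F)

lemma P_word_in_diagonal: "\<alpha> \<in> words n k \<Longrightarrow> P_word S \<alpha> \<in> diagonal n S"
  unfolding diagonal_def cstar_generated_def by auto

lemma P_word_in_D: "\<alpha> \<in> words n k \<Longrightarrow> P_word S \<alpha> \<in> D k"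
  unfolding D_alg_def using P_word_in_diagonal F_I by (auto simp: P_word_def)

lemma P_word_mult:
  assumes "\<alpha> \<in> words n k" "\<beta> \<in> words n k"
  shows "P_word S \<alpha> * P_word S \<beta> = (if \<alpha> = \<beta> then P_word S \<alpha> else 0)"
proof -
  have "P_word S \<alpha> * P_word S \<beta> = S_word S \<alpha> * (star (S_word S \<alpha>) * S_word S \<beta>) * star (S_word S \<beta>)"
    by (simp add: P_word_def mult.assoc)
  then show ?thesis using assms by (auto simp: star_S_word_mult_S_word P_word_def)
qed

lemma star_P_word [simp]: "star (P_word S \<alpha>) = P_word S \<alpha>"
  by (simp add: P_word_def star_mult star_star)

lemma sum_P_word: "(\<Sum>\<alpha>\<in>words n k. P_word S \<alpha>) = 1"
  using S_word_complete by (simp add: P_word_def)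

lemma span_P_word_Suc:
  "cvec.span (P_word S ` words n k) \<subseteq> cvec.span (P_word S ` words n (Suc k))"
proof (rule cvec.span_minimal; clarsimp)
  fix \<alpha> assume \<alpha>: "\<alpha> \<in> words n k"
  have "P_word S \<alpha> = S_word S \<alpha> * (\<Sum>i=1..n. S i * star (S i)) * star (S_word S \<alpha>)"
    unfolding S_complete by (simp add: P_word_def)
  also have "\<dots> = (\<Sum>i=1..n. P_word S (\<alpha> @ [i]))"
    by (simp add: P_word_def sum_distrib_left sum_distrib_right star_mult mult.assoc)
  also have "\<dots> \<in> cvec.span (P_word S ` words n (Suc k))"
    by (intro cvec.span_sum cvec.span_base imageI) (use \<alpha> in \<open>auto simp: words_def\<close>)
  finally show "P_word S \<alpha> \<in> cvec.span (P_word S ` words n (Suc k))" .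
qed

lemma span_P_word_mono:
  "k \<le> l \<Longrightarrow> cvec.span (P_word S ` words n k) \<subseteq> cvec.span (P_word S ` words n l)"
  using span_P_word_Suc by (rule lift_Suc_mono_le)

lemma P_word_commute_same_length:
  "\<alpha> \<in> words n k \<Longrightarrow> \<beta> \<in> words n k \<Longrightarrow> P_word S \<alpha> * P_word S \<beta> = P_word S \<beta> * P_word S \<alpha>"
  by (auto simp: P_word_mult)

lemma span_P_word_commute:
  assumes "x \<in> cvec.span (P_word S ` words n k)" "y \<in> cvec.span (P_word S ` words n k)"
  shows "x * y = y * x"
proof -
  have comm: "z * y = y * z" if "z \<in> P_word S ` words n k" for z
  proof -
    have "y * z - z * y \<in> {0}"
    proof (rule clinear_span_image[where f = "\<lambda>y. y * z - z * y", OF _ _ _ assms(2)])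
      show "clinear (\<lambda>y. y * z - z * y)"
        by (simp add: clinear_def algebra_simps mult_scaleC_left mult_scaleC_right cvec.scale_right_diff_distrib)
    qed (use that in \<open>auto simp: P_word_commute_same_length\<close>)
    then show ?thesis by simp
  qed
  have "x * y - y * x \<in> {0}"
  proof (rule clinear_span_image[where f = "\<lambda>x. x * y - y * x", OF _ _ _ assms(1)])
    show "clinear (\<lambda>x. x * y - y * x)"
      by (simp add: clinear_def algebra_simps mult_scaleC_left mult_scaleC_right cvec.scale_right_diff_distrib)
  qed (use comm in auto)
  then show ?thesis by simp
qed

lemma P_word_commute:
  assumes "\<alpha> \<in> words n k" "\<beta> \<in> words n l"
  shows "P_word S \<alpha> * P_word S \<beta> = P_word S \<beta> * P_word S \<alpha>"
proof (rule span_P_word_commute[where k = "max k l"])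
  show "P_word S \<alpha> \<in> cvec.span (P_word S ` words n (max k l))"
    using span_P_word_mono[of k "max k l"] assms by (auto intro: cvec.span_base)
  show "P_word S \<beta> \<in> cvec.span (P_word S ` words n (max k l))"
    using span_P_word_mono[of l "max k l"] assms by (auto intro: cvec.span_base)
qed

text \<open>The commutant of the projections \<open>P \<alpha>\<close> is a C*-subalgebra, and it contains these projections
because any two of them lie in a common span of mutually orthogonal projections.\<close>

lemma diagonal_commute_P_word:
  assumes "x \<in> diagonal n S" "\<alpha> \<in> words n k"
  shows "x * P_word S \<alpha> = P_word S \<alpha> * x"
proof -
  let ?X = "\<Union>k. P_word S ` words n k"
  have "?X \<subseteq> commutant ?X" using P_word_commute by (auto simp: commutant_def)
  moreover have "cstar_subalgebra (commutant ?X)"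
  proof (rule cstar_subalgebra_commutant)
    fix y assume "y \<in> ?X"
    then have "star y = y" by fastforce
    then show "star y \<in> ?X" using \<open>y \<in> ?X\<close> by (simp only:)
  qed
  ultimately have "diagonal n S \<subseteq> commutant ?X" unfolding diagonal_def cstar_generated_def by blast
  then show ?thesis using assms by (auto simp: commutant_def)
qed

text \<open>An element \<open>x\<close> of the diagonal commutes with the \<open>P \<alpha>\<close>, so \<open>x = \<Sum>\<alpha>. P \<alpha> x P \<alpha>\<close>; on matrix units
of \<open>F k\<close> this map is the projection onto the diagonal entries.\<close>

lemma D_eq_span: "D k = cvec.span (P_word S ` words n k)"
proof
  show "cvec.span (P_word S ` words n k) \<subseteq> D k"
    using P_word_in_D by (intro cvec.span_minimal subspace_D) auto
  show "D k \<subseteq> cvec.span (P_word S ` words n k)"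
  proof
    fix x assume x: "x \<in> D k"
    have "x = (\<Sum>\<alpha>\<in>words n k. P_word S \<alpha> * P_word S \<alpha>) * x"
      using sum_P_word by (simp add: P_word_mult)
    also have "\<dots> = (\<Sum>\<alpha>\<in>words n k. P_word S \<alpha> * x * P_word S \<alpha>)"
      using x diagonal_commute_P_word by (simp add: sum_distrib_right mult.assoc D_alg_def)
    also have "\<dots> \<in> cvec.span (P_word S ` words n k)"
    proof (intro cvec.span_sum)
      fix \<alpha> assume \<alpha>: "\<alpha> \<in> words n k"
      have "x \<in> F k" using x by (simp add: D_alg_def)
      then show "P_word S \<alpha> * x * P_word S \<alpha> \<in> cvec.span (P_word S ` words n k)"
      proof (rule F_image_subset[OF clinear_mult(1) cvec.subspace_span])
        fix \<beta> \<gamma> assume w: "\<beta> \<in> words n k" "\<gamma> \<in> words n k"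
        have "P_word S \<alpha> * (S_word S \<beta> * star (S_word S \<gamma>)) * P_word S \<alpha>
            = S_word S \<alpha> * (star (S_word S \<alpha>) * S_word S \<beta>) * (star (S_word S \<gamma>) * S_word S \<alpha>) * star (S_word S \<alpha>)"
          by (simp add: P_word_def mult.assoc)
        also have "\<dots> = (if \<alpha> = \<beta> \<and> \<gamma> = \<alpha> then P_word S \<alpha> else 0)"
          using \<alpha> w by (auto simp: star_S_word_mult_S_word P_word_def)
        also have "\<dots> \<in> cvec.span (P_word S ` words n k)"
          using \<alpha> by (auto intro: cvec.span_base cvec.span_zero)
        finally show "P_word S \<alpha> * (S_word S \<beta> * star (S_word S \<gamma>)) * P_word S \<alpha>
          \<in> cvec.span (P_word S ` words n k)" .
      qed
    qed
    finally show "x \<in> cvec.span (P_word S ` words n k)" .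
  qed
qed

lemma D_image_subset:
  assumes "clinear f" "cvec.subspace T" "x \<in> D k"
    and "\<And>\<alpha>. \<alpha> \<in> words n k \<Longrightarrow> f (P_word S \<alpha>) \<in> T"
  shows "f x \<in> T"
  using assms(3) unfolding D_eq_span
  by (rule clinear_span_image[OF assms(1,2), rotated]) (use assms(4) in blast)

lemma D_mono: "k \<le> l \<Longrightarrow> D k \<subseteq> D l"
  using F_mono by (auto simp: D_alg_def)

lemma D_0: "D 0 = cvec.span {1}"
  by (simp add: D_eq_span words_0 P_word_def)

lemma one_in_D: "1 \<in> D k"
  using D_mono[of 0 k] cvec.span_base[of 1 "{1}"] by (auto simp: D_0)

lemma D_subset_diagonal: "D k \<subseteq> diagonal n S"
  by (auto simp: D_alg_def)

lemma D_mult: "x \<in> D k \<Longrightarrow> y \<in> D k \<Longrightarrow> x * y \<in> D k"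
  using cstar_subalgebra_diagonal F_mult by (auto simp: D_alg_def cstar_subalgebra_def)

lemma D_star: "x \<in> D k \<Longrightarrow> star x \<in> D k"
  using cstar_subalgebra_diagonal F_star by (auto simp: D_alg_def cstar_subalgebra_def)

lemma diagonal_commute_D:
  assumes "x \<in> diagonal n S" "y \<in> D k"
  shows "x * y = y * x"
proof -
  have "x * y - y * x \<in> {0}"
  proof (rule D_image_subset[where f = "\<lambda>y. x * y - y * x", OF _ _ assms(2)])
    show "clinear (\<lambda>y. x * y - y * x)"
      by (simp add: clinear_def algebra_simps mult_scaleC_left mult_scaleC_right cvec.scale_right_diff_distrib)
  qed (use assms diagonal_commute_P_word in auto)
  then show ?thesis by simp
qed

lemma S_D_star_S:
  assumes "x \<in> D k" "i \<in> {1..n}" shows "S i * x * star (S i) \<in> D (Suc k)"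
proof (rule D_image_subset[OF clinear_mult(1) subspace_D assms(1)])
  fix \<alpha> assume "\<alpha> \<in> words n k"
  then have "P_word S (i # \<alpha>) \<in> D (Suc k)" using assms(2) by (intro P_word_in_D) (auto simp: words_Suc)
  then show "S i * P_word S \<alpha> * star (S i) \<in> D (Suc k)" by (simp add: P_word_def star_mult mult.assoc)
qed

lemma star_S_D_S:
  assumes "x \<in> D (Suc k)" "i \<in> {1..n}" "j \<in> {1..n}" shows "star (S i) * x * S j \<in> D k"
proof (rule D_image_subset[OF clinear_mult(1) subspace_D assms(1)])
  fix \<alpha> assume "\<alpha> \<in> words n (Suc k)"
  then obtain l \<beta> where \<alpha>: "\<alpha> = l # \<beta>" "l \<in> {1..n}" "\<beta> \<in> words n k" by (auto simp: words_Suc)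
  have "star (S i) * P_word S \<alpha> * S j = (star (S i) * S l) * P_word S \<beta> * (star (S l) * S j)"
    by (simp add: \<alpha> P_word_def star_mult mult.assoc)
  also have "\<dots> = (if i = l \<and> l = j then P_word S \<beta> else 0)"
    using \<alpha> assms by (simp add: star_S_mult_S)
  also have "\<dots> \<in> D k" using \<alpha> P_word_in_D cvec.subspace_0[OF subspace_D] by auto
  finally show "star (S i) * P_word S \<alpha> * S j \<in> D k" .
qed

lemma diagonal_eq_closure: "diagonal n S = closure (\<Union>k. D k)"
proof
  let ?D = "\<Union>k. D k"
  show "closure ?D \<subseteq> diagonal n S"
    using cstar_subalgebra_diagonal D_subset_diagonal
    by (intro closure_minimal) (auto simp: cstar_subalgebra_def)
  have common: "\<exists>l. x \<in> D l \<and> y \<in> D l" if "x \<in> ?D" "y \<in> ?D" for x y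
    using that D_mono by (metis UN_E max.cobounded1 max.cobounded2 subset_iff)
  have add: "x + y \<in> ?D" and mult: "x * y \<in> ?D" if "x \<in> ?D" "y \<in> ?D" for x y
  proof -
    obtain l where "x \<in> D l" "y \<in> D l" using common \<open>x \<in> ?D\<close> \<open>y \<in> ?D\<close> by blast
    then have "x + y \<in> D l" "x * y \<in> D l"
      by (simp_all add: cvec.subspace_add[OF subspace_D] D_mult)
    then show "x + y \<in> ?D" "x * y \<in> ?D" by blast+
  qed
  have scale: "c *\<^sub>C x \<in> ?D" and star: "star x \<in> ?D" if "x \<in> ?D" for c x
  proof -
    obtain l where "x \<in> D l" using \<open>x \<in> ?D\<close> by blast
    then have "c *\<^sub>C x \<in> D l" "star x \<in> D l"
      by (simp_all add: cvec.subspace_scale[OF subspace_D] D_star)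
    then show "c *\<^sub>C x \<in> ?D" "star x \<in> ?D" by blast+
  qed
  have "cstar_subalgebra (closure ?D)"
    unfolding cstar_subalgebra_def cvec.subspace_def
  proof (intro conjI ballI allI)
    have "0 \<in> ?D" using cvec.subspace_0[OF subspace_D[of 0]] by blast
    then show "0 \<in> closure ?D" using closure_subset by (rule rev_subsetD)
    fix x assume x: "x \<in> closure ?D"
    then obtain f where f: "\<And>m. f m \<in> ?D" "f \<longlonglongrightarrow> x" by (auto simp: closure_sequential)
    have lim: "z \<in> closure ?D" if "\<And>m. g m \<in> ?D" "g \<longlonglongrightarrow> z" for g z
      using that by (auto simp: closure_sequential)
    show "star x \<in> closure ?D"
      by (rule lim[where g = "\<lambda>m. star (f m)"]) (use f star tendsto_star in auto)
    show "c *\<^sub>C x \<in> closure ?D" for c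
    proof (rule lim[where g = "\<lambda>m. c *\<^sub>C f m"])
      show "(\<lambda>m. c *\<^sub>C f m) \<longlonglongrightarrow> c *\<^sub>C x"
        using continuous_on_tendsto_compose[OF continuous_on_scaleC[of UNIV c] f(2)] by simp
    qed (use f scale in auto)
    fix y assume "y \<in> closure ?D"
    then obtain g where g: "\<And>m. g m \<in> ?D" "g \<longlonglongrightarrow> y" by (auto simp: closure_sequential)
    show "x + y \<in> closure ?D"
      by (rule lim[where g = "\<lambda>m. f m + g m"]) (use f g add in \<open>auto intro: tendsto_add\<close>)
    show "x * y \<in> closure ?D"
      by (rule lim[where g = "\<lambda>m. f m * g m"]) (use f g mult in \<open>auto intro: tendsto_mult\<close>)
  qed simp
  moreover have "(\<Union>k. P_word S ` words n k) \<subseteq> closure ?D"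
    using P_word_in_D closure_subset by blast
  ultimately show "diagonal n S \<subseteq> closure ?D" unfolding diagonal_def cstar_generated_def by blast
qed

end

section \<open>Shifted elements and compressions to words\<close>

context cuntz
begin

lemma shift_mult_S: "i \<in> {1..n} \<Longrightarrow> shift n S x * S i = S i * x"
proof -
  assume i: "i \<in> {1..n}"
  have "shift n S x * S i = (\<Sum>l=1..n. S l * x * (star (S l) * S i))"
    by (simp add: shift_def sum_distrib_right mult.assoc)
  also have "\<dots> = (\<Sum>l=1..n. if l = i then S l * x else 0)"
    using i by (intro sum.cong) (auto simp: star_S_mult_S)
  finally show ?thesis using i by simp
qed

lemma star_S_mult_shift: "i \<in> {1..n} \<Longrightarrow> star (S i) * shift n S x = x * star (S i)"
proof -
  assume i: "i \<in> {1..n}"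
  have "star (S i) * shift n S x = (\<Sum>l=1..n. (star (S i) * S l) * x * star (S l))"
    by (simp add: shift_def sum_distrib_left mult.assoc)
  also have "\<dots> = (\<Sum>l=1..n. if l = i then x * star (S l) else 0)"
    using i by (intro sum.cong) (auto simp: star_S_mult_S)
  finally show ?thesis using i by simp
qed

lemma shift_power_mult_S_word:
  "\<alpha> \<in> words n m \<Longrightarrow> (shift n S ^^ m) x * S_word S \<alpha> = S_word S \<alpha> * x"
proof (induction m arbitrary: \<alpha>)
  case (Suc m)
  then obtain i \<beta> where \<alpha>: "\<alpha> = i # \<beta>" "i \<in> {1..n}" "\<beta> \<in> words n m" by (auto simp: words_Suc)
  have "(shift n S ^^ Suc m) x * S_word S \<alpha> = (shift n S ((shift n S ^^ m) x) * S i) * S_word S \<beta>"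
    by (simp add: \<alpha> mult.assoc)
  also have "\<dots> = S i * ((shift n S ^^ m) x * S_word S \<beta>)"
    unfolding shift_mult_S[OF \<alpha>(2)] by (simp add: mult.assoc)
  also have "\<dots> = S_word S \<alpha> * x" unfolding Suc.IH[OF \<alpha>(3)] by (simp add: \<alpha> mult.assoc)
  finally show ?case .
qed (simp add: words_0)

lemma star_S_word_mult_shift_power:
  "\<alpha> \<in> words n m \<Longrightarrow> star (S_word S \<alpha>) * (shift n S ^^ m) x = x * star (S_word S \<alpha>)"
proof (induction m arbitrary: \<alpha>)
  case (Suc m)
  then obtain i \<beta> where \<alpha>: "\<alpha> = i # \<beta>" "i \<in> {1..n}" "\<beta> \<in> words n m" by (auto simp: words_Suc)
  have "star (S_word S \<alpha>) * (shift n S ^^ Suc m) x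
      = star (S_word S \<beta>) * (star (S i) * shift n S ((shift n S ^^ m) x))"
    by (simp add: \<alpha> star_mult mult.assoc)
  also have "\<dots> = (star (S_word S \<beta>) * (shift n S ^^ m) x) * star (S i)"
    unfolding star_S_mult_shift[OF \<alpha>(2)] by (simp add: mult.assoc)
  also have "\<dots> = x * star (S_word S \<alpha>)" unfolding Suc.IH[OF \<alpha>(3)] by (simp add: \<alpha> star_mult mult.assoc)
  finally show ?case .
qed (simp add: words_0)

text \<open>The shift satisfies \<open>\<phi> x S i = S i x\<close> and \<open>(S i)\<^sup>* \<phi> x = x (S i)\<^sup>*\<close>. Hence \<open>\<phi>\<^sup>m x\<close> turns into
\<open>x\<close> when it is moved past a word of length \<open>m\<close>, and both products with \<open>S \<alpha> (S \<beta>)\<^sup>*\<close> equal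
\<open>S \<alpha> x (S \<beta>)\<^sup>*\<close>.\<close>

lemma F_commute_shift_power:
  assumes "y \<in> F m"
  shows "y * (shift n S ^^ m) x = (shift n S ^^ m) x * y"
proof -
  let ?z = "(shift n S ^^ m) x"
  have "y * ?z - ?z * y \<in> {0}"
  proof (rule F_image_subset[where f = "\<lambda>y. y * ?z - ?z * y", OF _ _ assms])
    show "clinear (\<lambda>y. y * ?z - ?z * y)"
      by (simp add: clinear_def algebra_simps mult_scaleC_left mult_scaleC_right cvec.scale_right_diff_distrib)
    fix \<alpha> \<beta> assume w: "\<alpha> \<in> words n m" "\<beta> \<in> words n m"
    have "S_word S \<alpha> * star (S_word S \<beta>) * ?z = S_word S \<alpha> * x * star (S_word S \<beta>)"
      using star_S_word_mult_shift_power[OF w(2)] by (simp add: mult.assoc)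
    moreover have "?z * (S_word S \<alpha> * star (S_word S \<beta>)) = S_word S \<alpha> * x * star (S_word S \<beta>)"
      using shift_power_mult_S_word[OF w(1)] by (simp flip: mult.assoc)
    ultimately show "S_word S \<alpha> * star (S_word S \<beta>) * ?z - ?z * (S_word S \<alpha> * star (S_word S \<beta>)) \<in> {0}"
      by simp
  qed simp
  then show ?thesis by simp
qed

lemma compression_D_scalar:
  assumes "x \<in> D s" "\<alpha> \<in> words n s" "\<beta> \<in> words n s"
  shows "star (S_word S \<alpha>) * x * S_word S \<beta> \<in> cvec.span {1}"
proof (rule D_image_subset[OF clinear_mult(1) cvec.subspace_span assms(1)])
  fix \<gamma> assume \<gamma>: "\<gamma> \<in> words n s"
  have "star (S_word S \<alpha>) * P_word S \<gamma> * S_word S \<beta>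
      = (star (S_word S \<alpha>) * S_word S \<gamma>) * (star (S_word S \<gamma>) * S_word S \<beta>)"
    by (simp add: P_word_def mult.assoc)
  also have "\<dots> \<in> cvec.span {1}"
    using \<gamma> assms by (auto simp: star_S_word_mult_S_word intro: cvec.span_base cvec.span_zero)
  finally show "star (S_word S \<alpha>) * P_word S \<gamma> * S_word S \<beta> \<in> cvec.span {1}" .
qed

lemma span_1_iff: "x \<in> cvec.span {1} \<longleftrightarrow> (\<exists>c. x = c *\<^sub>C 1)"
  by (auto simp: cvec.span_singleton)

lemma D_expansion:
  assumes "x \<in> D s"
  obtains c where "\<And>\<alpha>. \<alpha> \<in> words n s \<Longrightarrow> star (S_word S \<alpha>) * x * S_word S \<alpha> = c \<alpha> *\<^sub>C 1"
    and "x = (\<Sum>\<alpha>\<in>words n s. c \<alpha> *\<^sub>C P_word S \<alpha>)"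
proof -
  have "\<forall>\<alpha>\<in>words n s. \<exists>c. star (S_word S \<alpha>) * x * S_word S \<alpha> = c *\<^sub>C 1"
    using compression_D_scalar[OF assms] by (simp add: span_1_iff)
  then obtain c where c: "\<And>\<alpha>. \<alpha> \<in> words n s \<Longrightarrow> star (S_word S \<alpha>) * x * S_word S \<alpha> = c \<alpha> *\<^sub>C 1"
    by metis
  have "x = (\<Sum>\<alpha>\<in>words n s. P_word S \<alpha> * P_word S \<alpha>) * x"
    using sum_P_word by (simp add: P_word_mult)
  also have "\<dots> = (\<Sum>\<alpha>\<in>words n s. P_word S \<alpha> * x * P_word S \<alpha>)"
    using assms diagonal_commute_P_word by (simp add: sum_distrib_right mult.assoc D_alg_def)
  also have "\<dots> = (\<Sum>\<alpha>\<in>words n s. c \<alpha> *\<^sub>C P_word S \<alpha>)"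
  proof (rule sum.cong)
    fix \<alpha> assume "\<alpha> \<in> words n s"
    have "P_word S \<alpha> * x * P_word S \<alpha>
        = S_word S \<alpha> * (star (S_word S \<alpha>) * x * S_word S \<alpha>) * star (S_word S \<alpha>)"
      by (simp add: P_word_def mult.assoc)
    then show "P_word S \<alpha> * x * P_word S \<alpha> = c \<alpha> *\<^sub>C P_word S \<alpha>"
      using c \<open>\<alpha> \<in> words n s\<close> by (simp add: P_word_def mult_scaleC_left mult_scaleC_right)
  qed simp
  finally show thesis using c that by blast
qed

lemma sum_P_word_mult:
  "(\<Sum>\<alpha>\<in>words n s. a \<alpha> *\<^sub>C P_word S \<alpha>) * (\<Sum>\<alpha>\<in>words n s. b \<alpha> *\<^sub>C P_word S \<alpha>)
    = (\<Sum>\<alpha>\<in>words n s. (a \<alpha> * b \<alpha>) *\<^sub>C P_word S \<alpha>)"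
proof -
  have "(\<Sum>\<alpha>\<in>words n s. a \<alpha> *\<^sub>C P_word S \<alpha>) * (\<Sum>\<alpha>\<in>words n s. b \<alpha> *\<^sub>C P_word S \<alpha>)
      = (\<Sum>\<alpha>\<in>words n s. \<Sum>\<beta>\<in>words n s. (a \<alpha> * b \<beta>) *\<^sub>C (P_word S \<alpha> * P_word S \<beta>))"
    by (simp add: sum_product mult_scaleC_left mult_scaleC_right scaleC_scaleC mult.commute)
  also have "\<dots> = (\<Sum>\<alpha>\<in>words n s. \<Sum>\<beta>\<in>words n s. if \<beta> = \<alpha> then (a \<alpha> * b \<alpha>) *\<^sub>C P_word S \<alpha> else 0)"
    by (intro sum.cong refl) (auto simp: P_word_mult)
  finally show ?thesis by (simp add: finite_words)
qed

text \<open>The elements \<open>(S \<alpha>)\<^sup>* x S \<alpha>\<close> are the coefficients \<open>c \<alpha>\<close> of \<open>x = \<Sum>\<alpha>. c \<alpha> P \<alpha>\<close>, so the norm on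
\<open>D s\<close> is bounded by the maximum norm of the coefficients. The absolute value
\<open>h = \<Sum>\<alpha>. \<bar>c \<alpha>\<bar> P \<alpha>\<close> has the same norm as \<open>x\<close> and satisfies \<open>h\<^sup>2 + y\<^sup>2 = M\<^sup>2\<close> for a selfadjoint
\<open>y\<close> commuting with it.\<close>

lemma norm_D_le:
  assumes x: "x \<in> D s" and M: "0 \<le> M"
    and le: "\<And>\<alpha>. \<alpha> \<in> words n s \<Longrightarrow> norm (star (S_word S \<alpha>) * x * S_word S \<alpha>) \<le> M"
  shows "norm x \<le> M"
proof -
  obtain c where c: "\<And>\<alpha>. \<alpha> \<in> words n s \<Longrightarrow> star (S_word S \<alpha>) * x * S_word S \<alpha> = c \<alpha> *\<^sub>C 1"
    and x_eq: "x = (\<Sum>\<alpha>\<in>words n s. c \<alpha> *\<^sub>C P_word S \<alpha>)"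
    using D_expansion[OF x] by blast
  have cM: "cmod (c \<alpha>) \<le> M" if "\<alpha> \<in> words n s" for \<alpha>
    using le[OF that] by (simp add: c[OF that] norm_scaleC)
  \<comment> \<open>These are the coefficients of \<open>y = \<surd>(M\<^sup>2 - h\<^sup>2)\<close>.\<close>
  define d where "d \<alpha> = sqrt (M\<^sup>2 - (cmod (c \<alpha>))\<^sup>2)" for \<alpha>
  have d: "d \<alpha> * d \<alpha> = M\<^sup>2 - (cmod (c \<alpha>))\<^sup>2" if "\<alpha> \<in> words n s" for \<alpha>
    using cM[OF that] by (simp add: d_def power_mono)
  define h where "h = (\<Sum>\<alpha>\<in>words n s. complex_of_real (cmod (c \<alpha>)) *\<^sub>C P_word S \<alpha>)"
  define y where "y = (\<Sum>\<alpha>\<in>words n s. complex_of_real (d \<alpha>) *\<^sub>C P_word S \<alpha>)"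
  have sa: "star h = h" "star y = y" by (simp_all add: h_def y_def star_sum star_scaleC)
  have comm: "h * y = y * h" by (simp add: h_def y_def sum_P_word_mult mult.commute)
  have "h * h + y * y
      = (\<Sum>\<alpha>\<in>words n s. (complex_of_real ((cmod (c \<alpha>))\<^sup>2) + complex_of_real (d \<alpha> * d \<alpha>)) *\<^sub>C P_word S \<alpha>)"
    by (simp add: h_def y_def sum_P_word_mult sum.distrib scaleC_add_left power2_eq_square)
  also have "\<dots> = (\<Sum>\<alpha>\<in>words n s. complex_of_real (M\<^sup>2) *\<^sub>C P_word S \<alpha>)"
    by (intro sum.cong refl) (simp add: d)
  also have "\<dots> = complex_of_real (M\<^sup>2) *\<^sub>C 1"
    using sum_P_word by (simp flip: cvec.scale_sum_right)
  finally have "(norm h)\<^sup>2 \<le> M\<^sup>2"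
    using norm_le_norm_sum_squares[OF sa comm] by (simp add: norm_scaleC norm_power)
  moreover have "star x * x = h * h"
  proof -
    have mod_square: "cnj z * z = complex_of_real (cmod z) * complex_of_real (cmod z)" for z
      using complex_norm_square[of z] by (simp add: power2_eq_square mult.commute)
    have "star x = (\<Sum>\<alpha>\<in>words n s. cnj (c \<alpha>) *\<^sub>C P_word S \<alpha>)"
      by (simp add: x_eq star_sum star_scaleC)
    then have "star x * x = (\<Sum>\<alpha>\<in>words n s. (cnj (c \<alpha>) * c \<alpha>) *\<^sub>C P_word S \<alpha>)"
      by (simp add: x_eq sum_P_word_mult)
    also have "\<dots> = h * h"
      unfolding h_def sum_P_word_mult
      using mod_square by (intro sum.cong refl) simp
    finally show ?thesis .
  qed
  then have "(norm x)\<^sup>2 = (norm h)\<^sup>2"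
    using cstar_identity[of x] norm_square_selfadjoint[OF sa(1)] by simp
  ultimately have "(norm x)\<^sup>2 \<le> M\<^sup>2" by simp
  then show ?thesis using M by (rule power2_le_imp_le)
qed

end

section \<open>The maps \<open>a i j\<close> of a unitary normalizing the diagonal\<close>

locale diagonal_normalizing_unitary = cuntz +
  fixes k :: nat and w :: 'a
  assumes k_pos: "1 \<le> k" and w_F: "w \<in> F_alg n S k" and w_normalizer: "w \<in> diag_normalizer n S"
begin

abbreviation a where "a i j \<equiv> a_map S w i j"

abbreviation a_maps where "a_maps \<equiv> {a i j | i j. i \<in> {1..n} \<and> j \<in> {1..n}}"

abbreviation V where "V \<equiv> D (k - 1)"

abbreviation B where "B \<equiv> B_alg n S k w"

abbreviation X where "X \<equiv> iterated_span a_maps V"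

lemma w_unitary: "star w * w = 1" "w * star w = 1"
  using w_normalizer by (simp_all add: diag_normalizer_def unitary_def)

lemma clinear_a: "clinear (a i j)"
proof -
  have "a i j = (\<lambda>x. (star (S i) * w) * x * (star w * S j))"
    by (simp add: a_map_def fun_eq_iff mult.assoc)
  then show ?thesis by simp
qed

lemma a_1: "i \<in> {1..n} \<Longrightarrow> j \<in> {1..n} \<Longrightarrow> a i j 1 = (if i = j then 1 else 0)"
proof -
  have "a i j 1 = star (S i) * (w * star w) * S j" by (simp add: a_map_def mult.assoc)
  then show "i \<in> {1..n} \<Longrightarrow> j \<in> {1..n} \<Longrightarrow> a i j 1 = (if i = j then 1 else 0)"
    by (simp add: w_unitary star_S_mult_S)
qed

lemma conj_w_D:
  assumes "x \<in> D l" "k \<le> l"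
  shows "w * x * star w \<in> D l" and "star w * x * w \<in> D l"
proof -
  have x: "x \<in> diagonal n S" "x \<in> F l" using assms(1) by (auto simp: D_alg_def)
  have w: "w \<in> F l" "star w \<in> F l" using w_F F_mono[OF assms(2)] F_star by blast+
  have im: "(\<lambda>d. w * d * star w) ` diagonal n S = diagonal n S"
    using w_normalizer by (simp add: diag_normalizer_def)
  have "w * x * star w \<in> diagonal n S" using im x(1) by blast
  moreover have "star w * x * w \<in> diagonal n S"
  proof -
    obtain d where d: "d \<in> diagonal n S" "x = w * d * star w" using im x(1) by blast
    have "star w * x * w = (star w * w) * d * (star w * w)" by (simp add: d mult.assoc)
    then show ?thesis using d(1) by (simp add: w_unitary)
  qed
  ultimately show "w * x * star w \<in> D l" "star w * x * w \<in> D l"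
    using w x by (simp_all add: D_alg_def F_mult)
qed

text \<open>Conjugation by \<open>w\<close> preserves \<open>D (Suc l)\<close> as soon as \<open>w \<in> F (Suc l)\<close>, and \<open>x \<mapsto> S i\<^sup>* x S j\<close> removes
the first letter of each word. Thus \<open>a i j\<close> moves every element of a high level \<open>D l\<close> towards
\<open>D (k - 1)\<close>.\<close>

lemma a_D:
  assumes "x \<in> D (Suc l)" "k \<le> Suc l" "i \<in> {1..n}" "j \<in> {1..n}"
  shows "a i j x \<in> D l"
proof -
  have "a i j x = star (S i) * (w * x * star w) * S j" by (simp add: a_map_def mult.assoc)
  then show ?thesis using star_S_D_S[OF conj_w_D(1)[OF assms(1,2)] assms(3,4)] by simp
qed

lemma a_V:
  assumes "x \<in> V" "i \<in> {1..n}" "j \<in> {1..n}"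
  shows "a i j x \<in> V"
proof (rule a_D)
  show "x \<in> D (Suc (k - 1))" using assms(1) D_mono[of "k - 1" "Suc (k - 1)"] by auto
qed (use assms k_pos in auto)

lemma subspace_X: "cvec.subspace (X r)"
  using subspace_D by (rule subspace_iterated_span)

lemma X_Suc_subset: "X (Suc r) \<subseteq> X r"
  by (rule iterated_span_Suc_subset[OF subspace_D]) (use clinear_a a_V in auto)

lemma decseq_X: "decseq X"
  using X_Suc_subset by (simp add: decseq_Suc_iff)

lemma X_Suc_leI:
  assumes "cvec.subspace W" "\<And>i j x. i \<in> {1..n} \<Longrightarrow> j \<in> {1..n} \<Longrightarrow> x \<in> X r \<Longrightarrow> a i j x \<in> W"
  shows "X (Suc r) \<subseteq> W"
  unfolding iterated_span.simps by (rule cvec.span_minimal) (use assms in auto)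

lemma a_X: "x \<in> X r \<Longrightarrow> i \<in> {1..n} \<Longrightarrow> j \<in> {1..n} \<Longrightarrow> a i j x \<in> X (Suc r)"
  by (rule iterated_span_image) auto

lemma one_in_indices: "1 \<in> {1..n}"
proof (rule ccontr)
  assume "1 \<notin> {1..n}"
  then have "{1..n} = {}" by auto
  then show False using S_complete by simp
qed

lemma one_in_X: "1 \<in> X r"
proof (induction r)
  case (Suc r)
  then show ?case using a_X[OF Suc one_in_indices one_in_indices] a_1[OF one_in_indices one_in_indices] by simp
qed (simp add: one_in_D)

lemma scalars_subset_X: "cvec.span {1} \<subseteq> X r"
  by (rule cvec.span_minimal) (use one_in_X subspace_X in auto)

lemma subspace_B: "cvec.subspace B"
  by (auto simp: B_alg_def intro: cvec.subspace_inter subspace_commutant subspace_F)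

lemma one_in_B: "1 \<in> B"
  by (auto simp: B_alg_def commutant_def one_in_F cvec.span_base)

lemma scalars_subset_B: "cvec.span {1} \<subseteq> B \<inter> V"
  by (rule cvec.span_minimal) (use one_in_B subspace_B one_in_D subspace_D in \<open>auto intro: cvec.subspace_inter\<close>)

lemma B_subset_F: "B \<subseteq> F (k - 1)"
  using k_pos by (cases "k \<ge> 2") (auto simp: B_alg_def F_0)

text \<open>Elements of \<open>B\<close> commute with \<open>w\<close>.\<close>

lemma a_B_eq:
  assumes "k \<ge> 2" "x \<in> B"
  shows "a i j x = star (S i) * x * S j"
proof -
  have "(shift n S ^^ 0) w \<in> {(shift n S ^^ m) w | m. m \<le> k - 2}" by blast
  then have "x * w = w * x" using assms by (auto simp: B_alg_def commutant_def)
  then have "w * x * star w = x * (w * star w)" by (metis mult.assoc)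
  then show ?thesis by (simp add: a_map_def w_unitary) (metis mult.assoc mult.right_neutral w_unitary(2))
qed

text \<open>For \<open>k \<ge> 2\<close>, moving \<open>\<phi>\<^sup>m w\<close> past \<open>S j\<close> or \<open>(S i)\<^sup>*\<close> turns it into \<open>\<phi>\<^sup>m\<^sup>+\<^sup>1 w\<close>. For \<open>m < k - 2\<close> the element \<open>x\<close>
commutes with the latter by definition of \<open>B\<close>, and for \<open>m = k - 2\<close> because \<open>x \<in> F (k - 1)\<close>.\<close>

lemma a_B:
  assumes "x \<in> B" "i \<in> {1..n}" "j \<in> {1..n}"
  shows "a i j x \<in> B"
proof (cases "k \<ge> 2")
  case False
  then have "B = cvec.span {1}" by (simp add: B_alg_def)
  moreover have "a i j x \<in> cvec.span {1}" if "x \<in> cvec.span {1}"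
    by (rule clinear_span_image[OF clinear_a cvec.subspace_span _ that])
       (use assms a_1 in \<open>auto intro: cvec.span_base cvec.span_zero\<close>)
  ultimately show ?thesis using assms by simp
next
  case True
  have xF: "x \<in> F (k - 1)" using assms B_subset_F by blast
  have "a i j x * (shift n S ^^ m) w = (shift n S ^^ m) w * a i j x" if m: "m \<le> k - 2" for m
  proof -
    let ?v = "(shift n S ^^ m) w"
    have comm: "x * shift n S ?v = shift n S ?v * x"
    proof (cases "Suc m \<le> k - 2")
      case True
      then have "(shift n S ^^ Suc m) w \<in> {(shift n S ^^ m) w | m. m \<le> k - 2}" by blast
      then show ?thesis using assms(1) \<open>k \<ge> 2\<close> by (auto simp: B_alg_def commutant_def)
    next
      case False
      then have "Suc m = k - 1" using m \<open>k \<ge> 2\<close> by auto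
      then show ?thesis using F_commute_shift_power[OF xF, of w] by (metis funpow.simps(2) o_apply)
    qed
    have "a i j x * ?v = star (S i) * x * (S j * ?v)"
      by (simp add: a_B_eq[OF True assms(1)] mult.assoc)
    also have "\<dots> = star (S i) * (x * shift n S ?v) * S j"
      by (simp add: mult.assoc flip: shift_mult_S[OF assms(3)])
    also have "\<dots> = (star (S i) * shift n S ?v) * x * S j" by (simp add: comm mult.assoc)
    also have "\<dots> = ?v * a i j x"
      by (simp add: star_S_mult_shift[OF assms(2)] a_B_eq[OF True assms(1)] mult.assoc)
    finally show ?thesis .
  qed
  moreover have "a i j x \<in> F (k - 1)"
    unfolding a_B_eq[OF True assms(1)] using xF assms(2,3) by (rule star_S_F_S_same)
  ultimately show ?thesis using True by (auto simp: B_alg_def commutant_def)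
qed

text \<open>Inside \<open>B\<close> every application of an \<open>a i j\<close> lowers the level of \<open>F\<close> by one, so \<open>k - 1\<close> of them lead
from \<open>F (k - 1)\<close> to \<open>F 0 = \<complex>1\<close>.\<close>

lemma X_subset_scalars_if_subset_B:
  assumes "X r \<subseteq> B"
  shows "X (r + (k - 1)) \<subseteq> cvec.span {1}"
proof -
  have "X (r + l) \<subseteq> B \<inter> F (k - 1 - l)" if "l \<le> k - 1" for l
    using that
  proof (induction l)
    case 0
    then show ?case using assms B_subset_F by auto
  next
    case (Suc l)
    have IH: "X (r + l) \<subseteq> B \<inter> F (Suc (k - 1 - Suc l))"
      using Suc by (simp add: Suc_diff_Suc)
    show ?case unfolding add_Suc_right
    proof (rule X_Suc_leI[OF cvec.subspace_inter[OF subspace_B subspace_F]])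
      fix i j x assume *: "i \<in> {1..n}" "j \<in> {1..n}" "x \<in> X (r + l)"
      then have "x \<in> B" "x \<in> F (Suc (k - 1 - Suc l))" using IH by auto
      then show "a i j x \<in> B \<inter> F (k - 1 - Suc l)"
        using a_B[of x i j] star_S_F_S[of x _ i j] a_B_eq[of x i j] * Suc.prems by simp
    qed
  qed
  from this[of "k - 1"] show ?thesis by (simp add: F_0)
qed

text \<open>Since \<open>S i\<^sup>* w x w\<^sup>* S j = (w\<^sup>* S i)\<^sup>* x (w\<^sup>* S j)\<close>, the maps \<open>a i j\<close> multiply by the generators
of \<open>K\<^sup>*\<close> and \<open>K\<close>; sesquilinearity gives all of \<open>K\<close>. So \<open>\<Xi>\<close> is the intersection of the chain
\<open>X r\<close>, which stabilizes.\<close>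

lemma Xi_eq_X: obtains r where "Xi_space n S k w = X r" "\<And>s. r \<le> s \<Longrightarrow> X s = X r"
proof -
  let ?K = "K_space n S w"
  have sand: "sandwich ?K V r = X r" for r
  proof (induction r)
    case 0
    have "{prod_list (map star (rev ys)) * x * prod_list zs | ys x zs.
        x \<in> V \<and> set ys \<subseteq> ?K \<and> set zs \<subseteq> ?K \<and> length ys = 0 \<and> length zs = 0} = V"
      by auto
    then show ?case using subspace_D by (simp only: sandwich_def iterated_span.simps cvec.span_eq_iff[THEN iffD2])
  next
    case (Suc r)
    show ?case
    proof
      have step: "star y * g * z \<in> X (Suc r)" if g: "g \<in> X r" and y: "y \<in> ?K" and z: "z \<in> ?K" for y z g
      proof -
        have 1: "star (star w * S i) * g * z \<in> X (Suc r)" if i: "i \<in> {1..n}" for i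
        proof (rule clinear_span_image[where G = "(\<lambda>i. star w * S i) ` {1..n}", OF clinear_mult(2) subspace_X])
          fix u assume "u \<in> (\<lambda>i. star w * S i) ` {1..n}"
          then obtain j where "j \<in> {1..n}" "u = star w * S j" by auto
          then show "star (star w * S i) * g * u \<in> X (Suc r)"
            using a_X[OF g i] by (simp add: a_map_def star_mult star_star mult.assoc del: iterated_span.simps)
        qed (use z in \<open>simp add: K_space_def\<close>)
        show ?thesis
          using y unfolding K_space_def
        proof (induction rule: cvec.span_induct_alt)
          case base
          show ?case using subspace_X[of "Suc r"] by (simp add: cvec.subspace_0 del: iterated_span.simps)
        next
          case (step c u v)
          then have "star u * g * z \<in> X (Suc r)" using 1 by auto
          then have "cnj c *\<^sub>C (star u * g * z) + star v * g * z \<in> X (Suc r)"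
            using step.IH by (intro cvec.subspace_add cvec.subspace_scale subspace_X)
          then show ?case
            by (simp add: star_add star_scaleC distrib_right mult_scaleC_left del: iterated_span.simps)
        qed
      qed
      show "sandwich ?K V (Suc r) \<subseteq> X (Suc r)"
        unfolding sandwich_def
      proof (rule cvec.span_minimal[OF _ subspace_X], safe)
        fix ys x zs
        assume *: "x \<in> V" "set ys \<subseteq> ?K" "set zs \<subseteq> ?K" "length ys = Suc r" "length zs = Suc r"
        then obtain y ys' z zs' where yz: "ys = ys' @ [y]" "zs = zs' @ [z]"
          by (metis length_0_conv nat.distinct(1) rev_exhaust)
        have "prod_list (map star (rev ys')) * x * prod_list zs' \<in> X r"
          unfolding Suc.IH[symmetric] sandwich_def
          by (rule cvec.span_base) (use * yz in auto)
        then have "star y * (prod_list (map star (rev ys')) * x * prod_list zs') * z \<in> X (Suc r)"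
          by (rule step) (use * yz in auto)
        then show "prod_list (map star (rev ys)) * x * prod_list zs \<in> X (Suc r)"
          by (simp add: yz mult.assoc del: iterated_span.simps)
      qed
      show "X (Suc r) \<subseteq> sandwich ?K V (Suc r)"
      proof (rule X_Suc_leI)
        show "cvec.subspace (sandwich ?K V (Suc r))" by (simp add: sandwich_def)
        fix i j x assume *: "i \<in> {1..n}" "j \<in> {1..n}" "x \<in> X r"
        have "x \<in> sandwich ?K V r" using * Suc by simp
        then show "a i j x \<in> sandwich ?K V (Suc r)"
          unfolding sandwich_def
        proof (rule clinear_span_image[OF clinear_a cvec.subspace_span, rotated], safe)
          fix ys x zs
          assume **: "x \<in> V" "set ys \<subseteq> ?K" "set zs \<subseteq> ?K" "r = length ys" "length zs = length ys"
          have "star w * S l \<in> ?K" if "l \<in> {1..n}" for l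
            unfolding K_space_def using that by (intro cvec.span_base) auto
          moreover have "a i j (prod_list (map star (rev ys)) * x * prod_list zs)
            = prod_list (map star (rev (ys @ [star w * S i]))) * x * prod_list (zs @ [star w * S j])"
            by (simp add: a_map_def star_mult star_star mult.assoc)
          ultimately show "a i j (prod_list (map star (rev ys)) * x * prod_list zs) \<in>
            cvec.span {prod_list (map star (rev ys')) * x * prod_list zs' | ys' x zs'.
              x \<in> V \<and> set ys' \<subseteq> ?K \<and> set zs' \<subseteq> ?K \<and> length ys' = Suc (length ys) \<and> length zs' = Suc (length ys)}"
            using ** * by (intro cvec.span_base CollectI exI[of _ "ys @ [star w * S i]"]
               exI[of _ x] exI[of _ "zs @ [star w * S j]"]) simp
        qed
      qed
    qed
  qed
  obtain r where r: "(\<Inter>s. X s) = X r"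
    by (rule decreasing_subspaces_stabilize[OF decseq_X subspace_X, of "P_word S ` words n (k - 1)"])
       (use finite_words in \<open>auto simp: D_eq_span\<close>)
  show thesis
  proof (rule that[of r])
    show "Xi_space n S k w = X r" by (simp only: Xi_space_def sand r)
    show "X s = X r" if "r \<le> s" for s
      using decseqD[OF decseq_X that] r by blast
  qed
qed

lemma nilpotent_iff: "nilpotent_rng (VD_End n S k w) (A_ring n S k w) \<longleftrightarrow> (\<exists>m\<ge>1. X m \<subseteq> B \<inter> V)"
proof -
  interpret quotient_by_subspace V "B \<inter> V"
    by unfold_locales (intro subspace_D cvec.subspace_inter subspace_B)+
  have "{b_tilde n S k w i j | i j. i \<in> {1..n} \<and> j \<in> {1..n}} = quot_map V (B \<inter> V) ` a_maps"
    by (auto simp: b_tilde_def)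
  moreover have "nilpotent_rng R (generate_rng R (quot_map V (B \<inter> V) ` a_maps))
      \<longleftrightarrow> (\<exists>m\<ge>1. X m \<subseteq> B \<inter> V)"
    by (rule nilpotent_generate_rng_iff) (use clinear_a a_V a_B in auto)
  ultimately show ?thesis by (simp add: VD_End_def A_ring_def)
qed

lemma nilpotent_iff_Xi_subset:
  "nilpotent_rng (VD_End n S k w) (A_ring n S k w) \<longleftrightarrow> Xi_space n S k w \<subseteq> B \<inter> V"
proof -
  obtain r where r: "Xi_space n S k w = X r" "\<And>s. r \<le> s \<Longrightarrow> X s = X r" using Xi_eq_X by blast
  have "(\<exists>m\<ge>1. X m \<subseteq> B \<inter> V) \<longleftrightarrow> X r \<subseteq> B \<inter> V"
  proof
    assume "\<exists>m\<ge>1. X m \<subseteq> B \<inter> V"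
    then obtain m where "X m \<subseteq> B \<inter> V" by blast
    then show "X r \<subseteq> B \<inter> V" using r(2)[of "max r m"] decseqD[OF decseq_X, of m "max r m"] by auto
  next
    assume "X r \<subseteq> B \<inter> V"
    then show "\<exists>m\<ge>1. X m \<subseteq> B \<inter> V" using r(2)[of "Suc r"] by (intro exI[of _ "Suc r"]) auto
  qed
  then show ?thesis by (simp only: nilpotent_iff r(1))
qed

lemma Xi_eq_scalars_iff: "Xi_space n S k w = cvec.span {1} \<longleftrightarrow> (\<exists>m. X m \<subseteq> cvec.span {1})"
proof -
  obtain r where r: "Xi_space n S k w = X r" "\<And>s. r \<le> s \<Longrightarrow> X s = X r" using Xi_eq_X by blast
  show ?thesis
  proof
    assume "\<exists>m. X m \<subseteq> cvec.span {1}"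
    then obtain m where "X m \<subseteq> cvec.span {1}" by blast
    then have "X r \<subseteq> cvec.span {1}" using r(2)[of "max r m"] decseqD[OF decseq_X, of m "max r m"] by auto
    then show "Xi_space n S k w = cvec.span {1}" using r(1) scalars_subset_X by auto
  qed (use r in auto)
qed

lemma Xi_subset_iff_eq_scalars:
  "Xi_space n S k w \<subseteq> B \<inter> V \<longleftrightarrow> Xi_space n S k w = cvec.span {1}"
proof
  assume sub: "Xi_space n S k w \<subseteq> B \<inter> V"
  obtain r where r: "Xi_space n S k w = X r" by (rule Xi_eq_X)
  then have "X r \<subseteq> B" using sub by simp
  then show "Xi_space n S k w = cvec.span {1}"
    unfolding Xi_eq_scalars_iff by (blast dest: X_subset_scalars_if_subset_B)
qed (use scalars_subset_B in auto)

end

section \<open>Restricting the endomorphism to the diagonal\<close>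

locale cuntz_endomorphism = diagonal_normalizing_unitary +
  fixes lam :: "'a \<Rightarrow> 'a"
  assumes endo: "is_cuntz_endomorphism n S w lam"
begin

lemma lam_star_endo: "unital_star_endomorphism lam"
  using endo by (simp add: is_cuntz_endomorphism_def)

lemma lam_simps [simp]:
  "lam (x + y) = lam x + lam y" "lam (c *\<^sub>C x) = c *\<^sub>C lam x" "lam (x * y) = lam x * lam y"
  "lam (star x) = star (lam x)" "lam 1 = 1"
  using lam_star_endo by (simp_all add: unital_star_endomorphism_def)

lemma lam_S: "i \<in> {1..n} \<Longrightarrow> lam (S i) = star w * S i"
  using endo by (simp add: is_cuntz_endomorphism_def)

lemma clinear_lam: "clinear lam"
  by (simp add: clinear_def)

lemma lam_0 [simp]: "lam 0 = 0"
  using lam_simps(2)[of 0 0] by simp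

lemma lam_diff: "lam (x - y) = lam x - lam y"
  by (rule clinear_diff[OF clinear_lam])

lemma lam_sum: "lam (\<Sum>i\<in>I. f i) = (\<Sum>i\<in>I. lam (f i))"
  by (induction I rule: infinite_finite_induct) auto

text \<open>The compression to the isometries \<open>\<lambda>(S \<alpha>) = w\<^sup>* S \<alpha>\<^sub>1 w\<^sup>* S \<alpha>\<^sub>2 \<dots>\<close>, which is a composite of the
maps \<open>a i j\<close> with indices read off from \<open>\<alpha>\<close> and \<open>\<beta>\<close>.\<close>

definition cut where "cut \<alpha> \<beta> x = star (lam (S_word S \<alpha>)) * x * lam (S_word S \<beta>)"

lemma cut_Cons:
  "i \<in> {1..n} \<Longrightarrow> j \<in> {1..n} \<Longrightarrow> cut (i # \<alpha>) (j # \<beta>) x = cut \<alpha> \<beta> (a i j x)"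
  by (simp add: cut_def a_map_def lam_S star_mult star_star mult.assoc)

lemma cut_snoc:
  "i \<in> {1..n} \<Longrightarrow> j \<in> {1..n} \<Longrightarrow> cut (\<alpha> @ [i]) (\<beta> @ [j]) x = a i j (cut \<alpha> \<beta> x)"
  by (simp add: cut_def a_map_def lam_S star_mult star_star mult.assoc)

lemma cut_append: "cut (\<alpha> @ \<alpha>') (\<beta> @ \<beta>') x = cut \<alpha>' \<beta>' (cut \<alpha> \<beta> x)"
  by (simp add: cut_def star_mult mult.assoc)

lemma cut_D: "x \<in> D (k - 1 + l) \<Longrightarrow> \<alpha> \<in> words n l \<Longrightarrow> \<beta> \<in> words n l \<Longrightarrow> cut \<alpha> \<beta> x \<in> V"
proof (induction l arbitrary: x \<alpha> \<beta>)
  case 0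
  then show ?case by (simp add: words_0 cut_def)
next
  case (Suc l)
  then obtain i j \<alpha>' \<beta>' where eq: "\<alpha> = i # \<alpha>'" "\<beta> = j # \<beta>'" "i \<in> {1..n}" "j \<in> {1..n}"
    "\<alpha>' \<in> words n l" "\<beta>' \<in> words n l" by (auto simp: words_Suc)
  have "a i j x \<in> D (k - 1 + l)" using Suc.prems eq k_pos by (intro a_D) auto
  then show ?case using Suc.IH eq by (simp add: cut_Cons)
qed

lemma cut_X: "x \<in> X r \<Longrightarrow> \<alpha> \<in> words n l \<Longrightarrow> \<beta> \<in> words n l \<Longrightarrow> cut \<alpha> \<beta> x \<in> X (r + l)"
proof (induction l arbitrary: x \<alpha> \<beta> r)
  case 0
  then show ?case by (simp add: words_0 cut_def)
next
  case (Suc l)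
  then obtain i j \<alpha>' \<beta>' where eq: "\<alpha> = i # \<alpha>'" "\<beta> = j # \<beta>'" "i \<in> {1..n}" "j \<in> {1..n}"
    "\<alpha>' \<in> words n l" "\<beta>' \<in> words n l" by (auto simp: words_Suc)
  have "a i j x \<in> X (Suc r)" using Suc.prems(1) eq by (intro a_X)
  from Suc.IH[OF this eq(5,6)] show ?case using eq by (simp add: cut_Cons del: iterated_span.simps)
qed

lemma X_leI:
  assumes "cvec.subspace W" "\<And>\<alpha> \<beta> x. \<alpha> \<in> words n r \<Longrightarrow> \<beta> \<in> words n r \<Longrightarrow> x \<in> V \<Longrightarrow> cut \<alpha> \<beta> x \<in> W"
  shows "X r \<subseteq> W"
proof -
  have word: "\<exists>\<alpha>\<in>words n (length ts). \<exists>\<beta>\<in>words n (length ts). foldr (\<lambda>t y. t y) ts x = cut \<alpha> \<beta> x"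
    if "set ts \<subseteq> a_maps" for ts x
    using that
  proof (induction ts)
    case Nil
    then show ?case by (simp add: words_0 cut_def)
  next
    case (Cons t ts)
    then obtain \<alpha> \<beta> i j where *: "\<alpha> \<in> words n (length ts)" "\<beta> \<in> words n (length ts)"
      "foldr (\<lambda>t y. t y) ts x = cut \<alpha> \<beta> x" "i \<in> {1..n}" "j \<in> {1..n}" "t = a i j" by auto
    then have "foldr (\<lambda>t y. t y) (t # ts) x = cut (\<alpha> @ [i]) (\<beta> @ [j]) x" by (simp add: cut_snoc)
    moreover have "\<alpha> @ [i] \<in> words n (length (t # ts))" "\<beta> @ [j] \<in> words n (length (t # ts))"
      using * by (auto simp: words_def)
    ultimately show ?case by blast
  qed
  have "X r = cvec.span {foldr (\<lambda>t y. t y) ts x | ts x. set ts \<subseteq> a_maps \<and> length ts = r \<and> x \<in> V}"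
    by (rule iterated_span_eq_span_words[OF subspace_D]) (use clinear_a in auto)
  also have "\<dots> \<subseteq> W"
  proof (rule cvec.span_minimal[OF _ assms(1)], clarify)
    fix ts x assume *: "set ts \<subseteq> a_maps" "x \<in> V" "r = length ts"
    obtain \<alpha> \<beta> where "\<alpha> \<in> words n r" "\<beta> \<in> words n r" "foldr (\<lambda>t y. t y) ts x = cut \<alpha> \<beta> x"
      using word[OF *(1), of x] *(3) by blast
    then show "foldr (\<lambda>t y. t y) ts x \<in> W" using assms(2) *(2) by simp
  qed
  finally show ?thesis .
qed

text \<open>Induction on the word: \<open>\<lambda>(P (i \<beta>)) = w\<^sup>* S i \<lambda>(P \<beta>) (S i)\<^sup>* w\<close>, where the inner factors raise the
level by one and the level never drops below \<open>k\<close> before conjugating by \<open>w\<close>.\<close>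

lemma lam_P_word_D: "\<alpha> \<in> words n s \<Longrightarrow> lam (P_word S \<alpha>) \<in> D (s + (k - 1))"
proof (induction s arbitrary: \<alpha>)
  case 0
  then show ?case by (simp add: words_0 P_word_def one_in_D)
next
  case (Suc s)
  then obtain i \<beta> where \<alpha>: "\<alpha> = i # \<beta>" "i \<in> {1..n}" "\<beta> \<in> words n s" by (auto simp: words_Suc)
  have "lam (P_word S \<alpha>) = star w * (S i * lam (P_word S \<beta>) * star (S i)) * w"
    using \<alpha> by (simp add: P_word_def star_mult star_star lam_S mult.assoc)
  also have "\<dots> \<in> D (Suc (s + (k - 1)))"
    using Suc.IH[OF \<alpha>(3)] \<alpha>(2) k_pos by (intro conj_w_D S_D_star_S) auto
  finally show ?case by simp
qed

lemma lam_D: "x \<in> D s \<Longrightarrow> lam x \<in> D (s + (k - 1))"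
  by (rule D_image_subset[OF clinear_lam subspace_D]) (use lam_P_word_D in auto)

lemma lam_contractive: "norm (lam x) \<le> norm x"
  by (rule star_endomorphism_contractive[OF lam_star_endo])

text \<open>On \<open>D s\<close> the norm is read off from the scalars \<open>(S \<alpha>)\<^sup>* x S \<alpha>\<close>. These are fixed by \<open>\<lambda>\<close>, so they are
also compressions of \<open>\<lambda> x\<close> by isometries.\<close>

lemma norm_lam_D:
  assumes "x \<in> D s"
  shows "norm (lam x) = norm x"
proof (rule antisym[OF lam_contractive], rule norm_D_le[OF assms])
  fix \<alpha> assume \<alpha>: "\<alpha> \<in> words n s"
  let ?v = "lam (S_word S \<alpha>)"
  have "star (S_word S \<alpha>) * x * S_word S \<alpha> \<in> cvec.span {1}"
    using compression_D_scalar assms \<alpha> by blast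
  then obtain c where c: "star (S_word S \<alpha>) * x * S_word S \<alpha> = c *\<^sub>C 1" by (auto simp: span_1_iff)
  have "star ?v * ?v = lam (star (S_word S \<alpha>) * S_word S \<alpha>)" by simp
  also have "\<dots> = 1" using star_S_word_mult_S_word[OF \<alpha> \<alpha>] by (simp only: simp_thms if_True lam_simps(5))
  finally have v: "norm ?v = 1" using cstar_identity[of ?v] by (simp add: power2_eq_1_iff) (smt (verit) norm_ge_zero)
  have "norm (star (S_word S \<alpha>) * x * S_word S \<alpha>) = norm (lam (star (S_word S \<alpha>) * x * S_word S \<alpha>))"
    unfolding c by (simp add: norm_scaleC)
  also have "\<dots> = norm (star ?v * lam x * ?v)" by simp
  also have "\<dots> \<le> norm (star ?v) * norm (lam x) * norm ?v"
    by (meson norm_mult_ineq mult_right_mono norm_ge_zero order.trans)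
  finally show "norm (star (S_word S \<alpha>) * x * S_word S \<alpha>) \<le> norm (lam x)" by (simp add: v)
qed simp

lemma inj_on_lam_D: "inj_on lam (\<Union>s. D s)"
proof (rule inj_onI)
  fix x y assume "x \<in> (\<Union>s. D s)" "y \<in> (\<Union>s. D s)" and eq: "lam x = lam y"
  then obtain s t where "x \<in> D s" "y \<in> D t" by blast
  then have "x \<in> D (max s t)" "y \<in> D (max s t)" using D_mono[of s "max s t"] D_mono[of t "max s t"] by auto
  then have "x - y \<in> D (max s t)" by (intro cvec.subspace_diff subspace_D)
  then have "norm (x - y) = norm (lam (x - y))" by (simp add: norm_lam_D)
  then show "x = y" by (simp add: lam_diff eq)
qed

text \<open>An element \<open>x\<close> of the diagonal commutes with the projections \<open>\<lambda>(P \<alpha>)\<close>, which sum to \<open>1\<close>, so it is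
the sum of its corners \<open>\<lambda>(P \<alpha>) x \<lambda>(P \<alpha>) = \<lambda>(S \<alpha>) (cut \<alpha> \<alpha> x) \<lambda>(S \<alpha>)\<^sup>*\<close>. The first \<open>l\<close> letters
of \<open>\<alpha>\<close> bring the compression into \<open>V\<close> and the remaining \<open>m\<close> letters into \<open>X m\<close>, i.e. into the scalars.
Hence every corner is a multiple of \<open>\<lambda>(P \<alpha>)\<close>.\<close>

lemma D_subset_lam_image:
  assumes "X m \<subseteq> cvec.span {1}" "x \<in> D (k - 1 + l)"
  shows "x \<in> lam ` D (l + m)"
proof -
  let ?W = "words n (l + m)"
  have "\<exists>c. cut \<alpha> \<alpha> x = c *\<^sub>C 1" if \<alpha>: "\<alpha> \<in> ?W" for \<alpha>
  proof -
    define \<beta> \<gamma> where "\<beta> = take l \<alpha>" and "\<gamma> = drop l \<alpha>"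
    have w: "\<beta> \<in> words n l" "\<gamma> \<in> words n m" "\<alpha> = \<beta> @ \<gamma>"
      using \<alpha> set_take_subset[of l \<alpha>] set_drop_subset[of l \<alpha>] by (auto simp: words_def \<beta>_def \<gamma>_def)
    have "cut \<beta> \<beta> x \<in> X 0" using cut_D[OF assms(2) w(1) w(1)] by simp
    from cut_X[OF this w(2) w(2)] have "cut \<alpha> \<alpha> x \<in> X m" by (simp add: w(3) cut_append)
    then show ?thesis using assms(1) span_1_iff by blast
  qed
  then obtain c where c: "\<And>\<alpha>. \<alpha> \<in> ?W \<Longrightarrow> cut \<alpha> \<alpha> x = c \<alpha> *\<^sub>C 1" by metis
  have sum1: "(\<Sum>\<alpha>\<in>?W. lam (P_word S \<alpha>)) = 1" using sum_P_word[of "l + m"] by (metis lam_sum lam_simps(5))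
  have x: "x \<in> diagonal n S" using assms(2) D_subset_diagonal by blast
  have "x = (\<Sum>\<alpha>\<in>?W. lam (P_word S \<alpha>)) * x" by (simp add: sum1)
  also have "\<dots> = (\<Sum>\<alpha>\<in>?W. c \<alpha> *\<^sub>C lam (P_word S \<alpha>))"
    unfolding sum_distrib_right
  proof (rule sum.cong)
    fix \<alpha> assume \<alpha>: "\<alpha> \<in> ?W"
    let ?p = "lam (P_word S \<alpha>)" and ?v = "lam (S_word S \<alpha>)"
    have "?p * x = lam (P_word S \<alpha> * P_word S \<alpha>) * x" using P_word_mult[OF \<alpha> \<alpha>] by simp
    also have "\<dots> = ?p * (?p * x)" by (simp add: mult.assoc)
    also have "\<dots> = ?p * x * ?p" using diagonal_commute_D[OF x lam_P_word_D[OF \<alpha>]] by (simp add: mult.assoc)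
    also have "\<dots> = ?v * cut \<alpha> \<alpha> x * star ?v" by (simp add: P_word_def cut_def mult.assoc)
    also have "\<dots> = c \<alpha> *\<^sub>C ?p"
      using c[OF \<alpha>] by (simp add: P_word_def mult_scaleC_left mult_scaleC_right)
    finally show "?p * x = c \<alpha> *\<^sub>C ?p" .
  qed simp
  also have "\<dots> = lam (\<Sum>\<alpha>\<in>?W. c \<alpha> *\<^sub>C P_word S \<alpha>)" by (simp add: lam_sum)
  finally have "x = lam (\<Sum>\<alpha>\<in>?W. c \<alpha> *\<^sub>C P_word S \<alpha>)" .
  moreover have "(\<Sum>\<alpha>\<in>?W. c \<alpha> *\<^sub>C P_word S \<alpha>) \<in> D (l + m)"
    by (intro cvec.subspace_sum cvec.subspace_scale subspace_D P_word_in_D)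
  ultimately show ?thesis by (rule image_eqI)
qed

lemma lam_image_D_if_X_scalars:
  assumes "X m \<subseteq> cvec.span {1}"
  shows "lam ` (\<Union>s. D s) = (\<Union>s. D s)"
proof
  show "lam ` (\<Union>s. D s) \<subseteq> (\<Union>s. D s)" using lam_D by blast
  show "(\<Union>s. D s) \<subseteq> lam ` (\<Union>s. D s)"
  proof
    fix x assume "x \<in> (\<Union>s. D s)"
    then obtain s where "x \<in> D s" by blast
    then have "x \<in> D (k - 1 + s)" using D_mono[of s "k - 1 + s"] by auto
    then show "x \<in> lam ` (\<Union>s. D s)" using D_subset_lam_image[OF assms] by blast
  qed
qed

text \<open>As \<open>V\<close> is spanned by finitely many elements, \<open>V \<subseteq> \<lambda>(D m)\<close> for a single \<open>m\<close>. Compressing \<open>\<lambda> y\<close>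
with \<open>y \<in> D m\<close> by words of length \<open>m\<close> gives the image of the scalar \<open>(S \<alpha>)\<^sup>* y S \<beta>\<close>.\<close>

lemma X_scalars_if_lam_image_D:
  assumes "(\<Union>s. D s) \<subseteq> lam ` (\<Union>s. D s)"
  shows "\<exists>m. X m \<subseteq> cvec.span {1}"
proof -
  have "\<exists>s. P_word S \<alpha> \<in> lam ` D s" if "\<alpha> \<in> words n (k - 1)" for \<alpha>
    using assms P_word_in_D[OF that] by blast
  then obtain f where f: "\<And>\<alpha>. \<alpha> \<in> words n (k - 1) \<Longrightarrow> P_word S \<alpha> \<in> lam ` D (f \<alpha>)" by metis
  define m where "m = Max (f ` words n (k - 1))"
  have "D (f \<alpha>) \<subseteq> D m" if "\<alpha> \<in> words n (k - 1)" for \<alpha>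
    using that finite_words by (intro D_mono) (simp add: m_def)
  then have P: "P_word S \<alpha> \<in> lam ` D m" if "\<alpha> \<in> words n (k - 1)" for \<alpha>
    using f[OF that] that by blast
  have sub: "cvec.subspace (lam ` D m)"
    unfolding cvec.subspace_def
  proof (intro conjI ballI allI)
    show "0 \<in> lam ` D m" using cvec.subspace_0[OF subspace_D] by (metis image_eqI lam_0)
    show "x + y \<in> lam ` D m" if "x \<in> lam ` D m" "y \<in> lam ` D m" for x y
      using that cvec.subspace_add[OF subspace_D] by (auto simp flip: lam_simps(1))
    show "c *\<^sub>C x \<in> lam ` D m" if "x \<in> lam ` D m" for c x
      using that cvec.subspace_scale[OF subspace_D] by (auto simp flip: lam_simps(2))
  qed
  have V: "V \<subseteq> lam ` D m"
    unfolding D_eq_span[of "k - 1"] by (rule cvec.span_minimal[OF _ sub]) (use P in auto)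
  have "X m \<subseteq> cvec.span {1}"
  proof (rule X_leI[OF cvec.subspace_span])
    fix \<alpha> \<beta> x assume w: "\<alpha> \<in> words n m" "\<beta> \<in> words n m" "x \<in> V"
    then obtain y where y: "y \<in> D m" "x = lam y" using V by blast
    have "cut \<alpha> \<beta> x = lam (star (S_word S \<alpha>) * y * S_word S \<beta>)" by (simp add: cut_def y)
    moreover obtain c where "star (S_word S \<alpha>) * y * S_word S \<beta> = c *\<^sub>C 1"
      using compression_D_scalar[OF y(1) w(1,2)] by (auto simp: span_1_iff)
    ultimately show "cut \<alpha> \<beta> x \<in> cvec.span {1}" by (simp add: span_1_iff)
  qed
  then show ?thesis ..
qed

lemma restricts_to_algebraic_part_iff:
  "restricts_to_automorphism lam (\<Union>s. D s) \<longleftrightarrow> Xi_space n S k w = cvec.span {1}"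
  unfolding Xi_eq_scalars_iff restricts_to_automorphism_def bij_betw_def
  using inj_on_lam_D lam_image_D_if_X_scalars X_scalars_if_lam_image_D by blast

lemma continuous_on_lam: "continuous_on A lam"
  unfolding continuous_on_iff dist_norm
  by (metis lam_diff lam_contractive le_less_trans)

text \<open>The endomorphism is isometric on the algebraic part and continuous, hence isometric on its closure.
A preimage of a limit is the limit of the preimages, which form a Cauchy sequence.\<close>

lemma restricts_to_diagonal:
  assumes "restricts_to_automorphism lam (\<Union>s. D s)"
  shows "restricts_to_automorphism lam (diagonal n S)"
proof -
  let ?D = "\<Union>s. D s"
  have im: "lam ` ?D = ?D" using assms by (simp add: restricts_to_automorphism_def bij_betw_def)
  have iso: "norm (lam x) = norm x" if "x \<in> closure ?D" for x
  proof -
    have "closed {x. norm (lam x) = norm x}"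
      by (intro closed_Collect_eq continuous_on_norm continuous_on_lam continuous_on_id)
    moreover have "?D \<subseteq> {x. norm (lam x) = norm x}" using norm_lam_D by blast
    ultimately have "closure ?D \<subseteq> {x. norm (lam x) = norm x}" by (rule closure_minimal[rotated])
    then show ?thesis using that by blast
  qed
  have "inj_on lam (closure ?D)"
  proof (rule inj_onI)
    fix x y assume "x \<in> closure ?D" "y \<in> closure ?D" "lam x = lam y"
    then have "x - y \<in> closure ?D" "lam (x - y) = 0"
      unfolding diagonal_eq_closure[symmetric]
      by (simp_all add: cvec.subspace_diff[OF subspace_diagonal] lam_diff)
    then show "x = y" using iso[of "x - y"] by simp
  qed
  moreover have "lam ` closure ?D \<subseteq> closure ?D"
    using continuous_on_lam closed_closure by (rule image_closure_subset) (use im closure_subset in blast)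
  moreover have "closure ?D \<subseteq> lam ` closure ?D"
  proof
    fix y assume "y \<in> closure ?D"
    then obtain g where g: "\<And>m. g m \<in> ?D" "g \<longlonglongrightarrow> y" by (auto simp: closure_sequential)
    have "\<forall>m. \<exists>x\<in>?D. lam x = g m" using g(1) im by (metis imageE)
    then obtain f where f: "\<And>m. f m \<in> ?D" "\<And>m. lam (f m) = g m" by metis
    have fd: "f m \<in> diagonal n S" for m using f(1)[of m] D_subset_diagonal by blast
    have "dist (f m) (f l) = dist (g m) (g l)" for m l
    proof -
      have "f m - f l \<in> closure ?D"
        using fd unfolding diagonal_eq_closure[symmetric] by (simp add: cvec.subspace_diff[OF subspace_diagonal])
      then show ?thesis using iso[of "f m - f l"] by (simp add: dist_norm lam_diff f(2))
    qed
    moreover have "Cauchy g" using g(2) by (rule LIMSEQ_imp_Cauchy)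
    ultimately have "Cauchy f" by (simp add: Cauchy_def)
    then obtain x where x: "f \<longlonglongrightarrow> x" using Cauchy_convergent_iff convergent_def by blast
    then have "x \<in> closure ?D" using f(1) by (auto simp: closure_sequential)
    moreover have "lam x = y"
    proof (rule LIMSEQ_unique[OF _ g(2)])
      have "(\<lambda>m. lam (f m)) \<longlonglongrightarrow> lam x"
        using continuous_on_tendsto_compose[OF continuous_on_lam[of UNIV] x] by simp
      then show "g \<longlonglongrightarrow> lam x" by (simp add: f(2))
    qed
    ultimately show "y \<in> lam ` closure ?D" by blast
  qed
  ultimately show ?thesis
    unfolding restricts_to_automorphism_def bij_betw_def diagonal_eq_closure by blast
qed

end

theorem theorem3p4:
  fixes S :: "nat \<Rightarrow> 'a::cstar_algebra" and n k :: nat and w :: 'a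
    and lam_w :: "'a \<Rightarrow> 'a"
  assumes "n \<ge> 2" and "k \<ge> 1"
    and "cuntz_generators n S"
    and "w \<in> F_alg n S k \<inter> diag_normalizer n S"
    and "is_cuntz_endomorphism n S w lam_w"
  shows "(nilpotent_rng (VD_End n S k w) (A_ring n S k w)
            \<longrightarrow> restricts_to_automorphism lam_w (diagonal n S)) \<and>
         (restricts_to_automorphism lam_w (\<Union>s. D_alg n S s)
            \<longleftrightarrow> nilpotent_rng (VD_End n S k w) (A_ring n S k w)) \<and>
         (nilpotent_rng (VD_End n S k w) (A_ring n S k w)
            \<longleftrightarrow> Xi_space n S k w \<subseteq> B_alg n S k w \<inter> D_alg n S (k - 1)) \<and>
         (Xi_space n S k w \<subseteq> B_alg n S k w \<inter> D_alg n S (k - 1)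
            \<longleftrightarrow> Xi_space n S k w = cvec.span {1})"
proof -
  interpret cuntz_endomorphism n S k w lam_w
    using assms by unfold_locales auto
  show ?thesis
    using restricts_to_diagonal restricts_to_algebraic_part_iff
      nilpotent_iff_Xi_subset Xi_subset_iff_eq_scalars by blast
qed

end
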